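(* Let $\Gamma:\mathcal H^\Omega\to\mathcal H^\Omega\otimes\mathcal H^\Omega$ be the decomposition coproduct defined in the context. Then: (i) $\Gamma$ is coassociative, i.e. $(\Gamma\otimes\mathrm{Id})\circ\Gamma=(\mathrm{Id}\otimes\Gamma)\circ\Gamma$, and it is not cocommutative in general. (ii) $\Gamma$ is compatible with the quasi-shuffle product: $\Gamma(x\star y)=\Gamma(x)\star\Gamma(y)$ for all $x,y\in\mathcal H^\Omega$, where $\mathcal H^\Omega\otimes\mathcal H^\Omega$ carries the componentwise product $(a\otimes b)\star(c\otimes d)=(a\star c)\otimes(b\star d)$. Together with the linear form $\varepsilon_\Gamma$ given by $\varepsilon_\Gamma(\mathbf 1)=1$, $\varepsilon_\Gamma(\omega)=1$ for every letter $\omega\in\Omega$ and $\varepsilon_\Gamma(\bm\omega)=0$ for $|\bm\omega|\ge2$ as counit, $(\mathcal H^\Omega,\star,\Gamma)$ is a bialgebra. (iii) The Hopf algebra $(\mathcal H^\Omega,\star,\Delta)$ is a right comodule-Hopf algebra over the bialgebra $(\mathcal H^\Omega,\star,\Gamma)$, namely: $(\Delta\otimes\mathrm{Id})\circ\Gamma=(\mathrm{Id}\otimes\mathrm{Id}\otimes m_\star)\circ\tau_{23}\circ(\Gamma\otimes\Gamma)\circ\Delta$, where $m_\star(a\otimes b)=a\star b$ and $\tau_{23}(a\otimes b\otimes c\otimes d)=a\otimes c\otimes b\otimes d$; $(\varepsilon\otimes\mathrm{Id})\circ\Gamma=u\circ\varepsilon$, where $u:\bm k\to\mathcal H^\Omega$,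 $u(\lambda)=\lambda\mathbf 1$; $\Gamma\circ S=(S\otimes\mathrm{Id})\circ\Gamma$. All maps occurring in these identities are algebra morphisms for the quasi-shuffle product.
   Context: Let $\bm k$ be a field and $\Omega$ a set endowed with a commutative semigroup law written additively; for $a,b\in\Omega$, $[a+b]\in\Omega$ denotes their sum in $\Omega$ (brackets distinguish it from formal linear combinations). $\Omega^*$ is the free monoid of words $\bm\omega=\omega_1\cdots\omega_n$ ($\omega_i\in\Omega$) under concatenation, with empty word $\mathbf 1$; $|\bm\omega|=n$ is the length and, for $n\ge1$, $\|\bm\omega\|=[\omega_1+\cdots+\omega_n]\in\Omega$ is the weight, viewed as a one-letter word. $\mathcal H^\Omega$ is the $\bm k$-vector space with basis $\Omega^*$. The quasi-shuffle product $\star$ on $\mathcal H^\Omega$ is the bilinear product defined by $\mathbf 1\star\bm\omega=\bm\omega\star\mathbf 1=\bm\omega$ and $a\bm u\star b\bm v=a(\bm u\star b\bm v)+b(a\bm u\star\bm v)+[a+b](\bm u\star\bm v)$ for letters $a,b\in\Omega$ and words $\bm u,\bm v$; it is associative and commutative. The deconcatenation coproduct is $\Delta(\bm\omega)=\sum_{\bm\omega'\bm\omega''=\bm\omega}\bm\omega'\otimes\bm\omega''$ (sum over all ways of writing $\bm\omega$ as a concatenation of two possibly empty words). $(\mathcal H^\Omega,\star,\Delta)$ is a commutative Hopf algebra (Hoffman) with unit $\mathbf 1$, counit $\varepsilon$ ($\varepsilon(\mathbf 1)=1$, $\varepsilon(\bm\omega)=0$ for $\bm\omega\neq\mathbf 1$)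 and antipode $S$. The decomposition coproduct $\Gamma$ is the linear map with $\Gamma(\mathbf 1)=\mathbf 1\otimes\mathbf 1$ and, for a nonempty word $\bm\omega$, $$\Gamma(\bm\omega)=\sum_{s\ge1}\ \sum_{\bm\omega=\bm\omega^1\cdots\bm\omega^s}\|\bm\omega^1\|\cdots\|\bm\omega^s\|\otimes\bm\omega^1\star\cdots\star\bm\omega^s,$$ where the inner sum runs over all ways of writing $\bm\omega$ as a concatenation of $s$ nonempty words and $\|\bm\omega^1\|\cdots\|\bm\omega^s\|$ is the word of length $s$ whose letters are the weights of the pieces. *)

theory Defs
  imports Main "HOL-Library.Poly_Mapping"
begin

text \<open>An element of the k-vector space with basis B is a finitely supported
  function B =>0 k. The tensor product of free spaces with bases B and C is the
  free space with basis B \<times> C. H^Omega is ('a list =>0 'k), words being lists.\<close>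

definition smult_pm :: "'k::field \<Rightarrow> ('b \<Rightarrow>\<^sub>0 'k) \<Rightarrow> ('b \<Rightarrow>\<^sub>0 'k)" where
  "smult_pm c p = Poly_Mapping.map ((*) c) p"

abbreviation bvec :: "'b \<Rightarrow> ('b \<Rightarrow>\<^sub>0 'k::field)" where
  "bvec b \<equiv> Poly_Mapping.single b 1"

definition lin :: "('b \<Rightarrow> ('c \<Rightarrow>\<^sub>0 'k::field)) \<Rightarrow> ('b \<Rightarrow>\<^sub>0 'k) \<Rightarrow> ('c \<Rightarrow>\<^sub>0 'k)" where
  "lin f x = (\<Sum>b\<in>Poly_Mapping.keys x. smult_pm (Poly_Mapping.lookup x b) (f b))"

definition linf :: "('b \<Rightarrow> 'k::field) \<Rightarrow> ('b \<Rightarrow>\<^sub>0 'k) \<Rightarrow> 'k" where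
  "linf f x = (\<Sum>b\<in>Poly_Mapping.keys x. Poly_Mapping.lookup x b * f b)"

definition bil :: "('b \<Rightarrow> 'c \<Rightarrow> ('d \<Rightarrow>\<^sub>0 'k::field)) \<Rightarrow> ('b \<Rightarrow>\<^sub>0 'k) \<Rightarrow> ('c \<Rightarrow>\<^sub>0 'k) \<Rightarrow> ('d \<Rightarrow>\<^sub>0 'k)" where
  "bil f x y = lin (\<lambda>b. lin (\<lambda>c. f b c) y) x"

definition tensor :: "('b \<Rightarrow>\<^sub>0 'k::field) \<Rightarrow> ('c \<Rightarrow>\<^sub>0 'k) \<Rightarrow> (('b \<times> 'c) \<Rightarrow>\<^sub>0 'k)" where
  "tensor x y = bil (\<lambda>b c. bvec (b, c)) x y"

definition tmap :: "(('b \<Rightarrow>\<^sub>0 'k::field) \<Rightarrow> ('d \<Rightarrow>\<^sub>0 'k)) \<Rightarrow> (('c \<Rightarrow>\<^sub>0 'k) \<Rightarrow> ('e \<Rightarrow>\<^sub>0 'k))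
    \<Rightarrow> (('b \<times> 'c) \<Rightarrow>\<^sub>0 'k) \<Rightarrow> (('d \<times> 'e) \<Rightarrow>\<^sub>0 'k)" where
  "tmap f g = lin (\<lambda>(b, c). tensor (f (bvec b)) (g (bvec c)))"

text \<open>f \<otimes> Id for a linear form f, followed by the canonical identification k \<otimes> V = V\<close>
definition tmapf_left :: "(('b \<Rightarrow>\<^sub>0 'k::field) \<Rightarrow> 'k) \<Rightarrow> (('b \<times> 'c) \<Rightarrow>\<^sub>0 'k) \<Rightarrow> ('c \<Rightarrow>\<^sub>0 'k)" where
  "tmapf_left f = lin (\<lambda>(b, c). smult_pm (f (bvec b)) (bvec c))"

text \<open>Id \<otimes> f for a linear form f, followed by the identification V \<otimes> k = V\<close>
definition tmapf_right :: "(('c \<Rightarrow>\<^sub>0 'k::field) \<Rightarrow> 'k) \<Rightarrow> (('b \<times> 'c) \<Rightarrow>\<^sub>0 'k) \<Rightarrow> ('b \<Rightarrow>\<^sub>0 'k)" where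
  "tmapf_right f = lin (\<lambda>(b, c). smult_pm (f (bvec c)) (bvec b))"

definition tassoc :: "((('b \<times> 'c) \<times> 'd) \<Rightarrow>\<^sub>0 'k::field) \<Rightarrow> (('b \<times> ('c \<times> 'd)) \<Rightarrow>\<^sub>0 'k)" where
  "tassoc = lin (\<lambda>((b, c), d). bvec (b, (c, d)))"

definition tflip :: "(('b \<times> 'c) \<Rightarrow>\<^sub>0 'k::field) \<Rightarrow> (('c \<times> 'b) \<Rightarrow>\<^sub>0 'k)" where
  "tflip = lin (\<lambda>(b, c). bvec (c, b))"

definition tau23 :: "((('b \<times> 'c) \<times> ('d \<times> 'e)) \<Rightarrow>\<^sub>0 'k::field) \<Rightarrow> ((('b \<times> 'd) \<times> ('c \<times> 'e)) \<Rightarrow>\<^sub>0 'k)" where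
  "tau23 = lin (\<lambda>((a, b), (c, d)). bvec ((a, c), (b, d)))"

definition tprod :: "(('b \<Rightarrow>\<^sub>0 'k::field) \<Rightarrow> ('b \<Rightarrow>\<^sub>0 'k) \<Rightarrow> ('b \<Rightarrow>\<^sub>0 'k))
    \<Rightarrow> (('c \<Rightarrow>\<^sub>0 'k) \<Rightarrow> ('c \<Rightarrow>\<^sub>0 'k) \<Rightarrow> ('c \<Rightarrow>\<^sub>0 'k))
    \<Rightarrow> (('b \<times> 'c) \<Rightarrow>\<^sub>0 'k) \<Rightarrow> (('b \<times> 'c) \<Rightarrow>\<^sub>0 'k) \<Rightarrow> (('b \<times> 'c) \<Rightarrow>\<^sub>0 'k)" where
  "tprod p q = bil (\<lambda>(a, b) (c, d). tensor (p (bvec a) (bvec c)) (q (bvec b) (bvec d)))"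

definition alg_hom :: "('x \<Rightarrow> 'x \<Rightarrow> 'x) \<Rightarrow> 'x \<Rightarrow> ('y \<Rightarrow> 'y \<Rightarrow> 'y) \<Rightarrow> 'y \<Rightarrow> ('x \<Rightarrow> 'y) \<Rightarrow> bool" where
  "alg_hom p1 e1 p2 e2 f \<longleftrightarrow> (\<forall>x y. f (p1 x y) = p2 (f x) (f y)) \<and> f e1 = e2"

text \<open>Omega is a commutative semigroup: type class ab_semigroup_add.\<close>

definition cons_lin :: "'a \<Rightarrow> ('a list \<Rightarrow>\<^sub>0 'k::field) \<Rightarrow> ('a list \<Rightarrow>\<^sub>0 'k)" where
  "cons_lin a = lin (\<lambda>w. bvec (a # w))"

fun qsh :: "'a::ab_semigroup_add list \<Rightarrow> 'a list \<Rightarrow> ('a list \<Rightarrow>\<^sub>0 'k::field)" where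
  "qsh [] v = bvec v"
| "qsh u [] = bvec u"
| "qsh (a # u) (b # v) = cons_lin a (qsh u (b # v)) + cons_lin b (qsh (a # u) v)
     + cons_lin (a + b) (qsh u v)"

definition star :: "('a::ab_semigroup_add list \<Rightarrow>\<^sub>0 'k::field) \<Rightarrow> ('a list \<Rightarrow>\<^sub>0 'k) \<Rightarrow> ('a list \<Rightarrow>\<^sub>0 'k)" where
  "star = bil qsh"

abbreviation one_H :: "('a list \<Rightarrow>\<^sub>0 'k::field)" where
  "one_H \<equiv> bvec []"

abbreviation star2 where "star2 \<equiv> tprod star star"

fun weight :: "'a::ab_semigroup_add list \<Rightarrow> 'a" where
  "weight [a] = a"
| "weight (a # b # w) = a + weight (b # w)"
| "weight [] = undefined"

definition Delta :: "('a list \<Rightarrow>\<^sub>0 'k::field) \<Rightarrow> (('a list \<times> 'a list) \<Rightarrow>\<^sub>0 'k)" where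
  "Delta = lin (\<lambda>w. \<Sum>i\<in>{0..length w}. bvec (take i w, drop i w))"

definition eps :: "('a list \<Rightarrow>\<^sub>0 'k::field) \<Rightarrow> 'k" where
  "eps = linf (\<lambda>w. if w = [] then 1 else 0)"

definition unitH :: "'k::field \<Rightarrow> ('a list \<Rightarrow>\<^sub>0 'k)" where
  "unitH c = smult_pm c one_H"

definition decomps :: "'a list \<Rightarrow> 'a list list set" where
  "decomps w = {ws. concat ws = w \<and> ws \<noteq> [] \<and> (\<forall>u\<in>set ws. u \<noteq> [])}"

definition Gamma_w :: "'a::ab_semigroup_add list \<Rightarrow> (('a list \<times> 'a list) \<Rightarrow>\<^sub>0 'k::field)" where
  "Gamma_w w = (if w = [] then bvec ([], [])
     else (\<Sum>ws\<in>decomps w. tensor (bvec (map weight ws)) (foldr star (map bvec ws) one_H)))"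

definition Gamma :: "('a::ab_semigroup_add list \<Rightarrow>\<^sub>0 'k::field) \<Rightarrow> (('a list \<times> 'a list) \<Rightarrow>\<^sub>0 'k)" where
  "Gamma = lin Gamma_w"

definition eps_Gamma :: "('a list \<Rightarrow>\<^sub>0 'k::field) \<Rightarrow> 'k" where
  "eps_Gamma = linf (\<lambda>w. if length w \<le> 1 then 1 else 0)"

text \<open>Antipode of (H, \<star>, Delta): S(1) = 1 and, for w nonempty,
  sum over w = u v of S(u) \<star> v equals 0, i.e.
  S(w) = - sum over the proper prefixes u of w (w = u v, v nonempty) of S(u) \<star> v.\<close>
function S_w :: "'a::ab_semigroup_add list \<Rightarrow> ('a list \<Rightarrow>\<^sub>0 'k::field)" where
  "S_w w = (if w = [] then one_H
     else - (\<Sum>i\<in>{0..<length w}. star (S_w (take i w)) (bvec (drop i w))))"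
  by auto
termination by (relation "measure length") auto

definition S :: "('a::ab_semigroup_add list \<Rightarrow>\<^sub>0 'k::field) \<Rightarrow> ('a list \<Rightarrow>\<^sub>0 'k)" where
  "S = lin S_w"

end

theory Submission
  imports Defs "HOL.Vector_Spaces"
begin

text \<open>Write \<open>\<theta>(u)\<close> for the weight of a nonempty word u paired with u, and 0 for the empty word, and let
  the pair (a, r) act on H \<open>\<otimes>\<close> A by p \<open>\<otimes>\<close> q \<open>\<mapsto>\<close> ap \<open>\<otimes>\<close> rq. Splitting off the first piece of a decomposition gives
  \<open>\<Gamma>(w) = \<Sum> \<theta>(u) \<Gamma>(v)\<close> over w = uv, that is, \<open>\<Gamma>\<close> is determined by \<open>\<Delta>\<close>. These actions obey the same
  three-term rule as the quasi-shuffle product, and all words of a product of two nonempty words have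
  the same weight; with the multiplicativity of \<open>\<Delta>\<close> this makes \<open>\<Gamma>\<close> multiplicative. The comodule
  identity follows by the same recursion. Coassociativity then follows, since by the comodule identity
  both sides satisfy one recursion. The antipode identities express uniqueness of convolution inverses.\<close>

subsection \<open>Linear maps between free vector spaces\<close>

text \<open>The second tensor factor is kept abstract, as a commutative algebra A. For \<Gamma>
  itself A = H, but the two iterated coproducts in the coassociativity law live in H \<otimes> (H
  \<otimes> H), where the same actions are needed with A = H \<otimes> H. Commutativity of A is what
  brings the second factors of the three terms into line. The weight is defined on words only, so a
  recursion for \<Gamma> on words says nothing yet about a product of words, which is a linear
  combination. The recursion is therefore restated as an identity of linear maps, with a counit term
  for the empty word. No convolution algebra is built for the antipode. Two candidates for a left
  inverse give equal sums over all cuts, all summands but one agree by induction on length, and the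
  second factor of the remaining summand is the unit, so the candidates agree there too.\<close>

lemma lookup_smult_pm [simp]:
  "Poly_Mapping.lookup (smult_pm c p) b = c * Poly_Mapping.lookup p b"
  unfolding smult_pm_def Poly_Mapping.map.rep_eq by (simp add: when_def)

interpretation pm: vector_space "smult_pm :: 'k::field \<Rightarrow> ('b \<Rightarrow>\<^sub>0 'k) \<Rightarrow> _"
  by standard (rule poly_mapping_eqI, simp add: lookup_add algebra_simps)+

lemma vector_space_mult: "vector_space ((*) :: 'k::field \<Rightarrow> 'k \<Rightarrow> 'k)"
  by standard (simp_all add: algebra_simps)

abbreviation linmap :: "(('b \<Rightarrow>\<^sub>0 'k::field) \<Rightarrow> ('c \<Rightarrow>\<^sub>0 'k)) \<Rightarrow> bool" where
  "linmap \<equiv> Vector_Spaces.linear smult_pm smult_pm"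

abbreviation linform :: "(('b \<Rightarrow>\<^sub>0 'k::field) \<Rightarrow> 'k) \<Rightarrow> bool" where
  "linform \<equiv> Vector_Spaces.linear smult_pm (*)"

lemma linmap_iff:
  "linmap f \<longleftrightarrow> (\<forall>x y. f (x + y) = f x + f y) \<and> (\<forall>c x. f (smult_pm c x) = smult_pm c (f x))"
  by (simp add: Vector_Spaces.linear_iff pm.vector_space_axioms)

lemma linform_iff:
  "linform f \<longleftrightarrow> (\<forall>x y. f (x + y) = f x + f y) \<and> (\<forall>c x. f (smult_pm c x) = c * f x)"
  by (simp add: Vector_Spaces.linear_iff pm.vector_space_axioms vector_space_mult)

text \<open>The target scaling \<open>s\<close> is left open so that one argument serves both maps
  into free spaces and linear forms with values in the field.\<close>

lemma linear_basis_expansion: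
  assumes "Vector_Spaces.linear smult_pm s f"
  shows "f x = (\<Sum>b\<in>Poly_Mapping.keys x. s (Poly_Mapping.lookup x b) (f (bvec b)))"
proof -
  interpret Vector_Spaces.linear smult_pm s f by fact
  have "x = (\<Sum>b\<in>Poly_Mapping.keys x. smult_pm (Poly_Mapping.lookup x b) (bvec b))"
    by (rule poly_mapping_eqI) (simp add: lookup_sum lookup_single when_def in_keys_iff if_distrib sum.delta cong: if_cong)
  then have "f x = f (\<Sum>b\<in>Poly_Mapping.keys x. smult_pm (Poly_Mapping.lookup x b) (bvec b))"
    by simp
  also have "\<dots> = (\<Sum>b\<in>Poly_Mapping.keys x. s (Poly_Mapping.lookup x b) (f (bvec b)))"
    by (simp add: sum scale)
  finally show ?thesis .
qed

lemma linear_eqI: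
  assumes "Vector_Spaces.linear smult_pm s f" "Vector_Spaces.linear smult_pm s g"
    and "\<And>b. f (bvec b) = g (bvec b)"
  shows "f x = g x"
  using linear_basis_expansion[OF assms(1), of x] linear_basis_expansion[OF assms(2), of x] assms(3)
  by simp

text \<open>Cancellation can make the support of \<open>x + y\<close> smaller than the union of the
  supports; a common finite superset lets the values of \<open>lin f\<close> at several vectors be
  compared.\<close>

lemma lin_superset:
  assumes "finite A" "Poly_Mapping.keys x \<subseteq> A"
  shows "lin f x = (\<Sum>b\<in>A. smult_pm (Poly_Mapping.lookup x b) (f b))"
  unfolding lin_def using assms
  by (intro sum.mono_neutral_left) (auto simp: in_keys_iff)

lemma linf_superset:
  assumes "finite A" "Poly_Mapping.keys x \<subseteq> A"
  shows "linf f x = (\<Sum>b\<in>A. Poly_Mapping.lookup x b * f b)"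
  unfolding linf_def using assms
  by (intro sum.mono_neutral_left) (auto simp: in_keys_iff)

lemma linmap_lin:
  fixes f :: "'b \<Rightarrow> ('c \<Rightarrow>\<^sub>0 'k::field)"
  shows "linmap (lin f)"
  unfolding linmap_iff
proof (intro conjI allI)
  fix x y :: "'b \<Rightarrow>\<^sub>0 'k"
  let ?A = "Poly_Mapping.keys x \<union> Poly_Mapping.keys y"
  show "lin f (x + y) = lin f x + lin f y"
    using Poly_Mapping.keys_add[of x y]
    by (simp add: lin_superset[of ?A] lookup_add pm.scale_left_distrib sum.distrib)
next
  fix c and x :: "'b \<Rightarrow>\<^sub>0 'k"
  have "Poly_Mapping.keys (smult_pm c x) \<subseteq> Poly_Mapping.keys x"
    by (auto simp: in_keys_iff)
  then show "lin f (smult_pm c x) = smult_pm c (lin f x)"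
    by (simp add: lin_superset[of "Poly_Mapping.keys x"] pm.scale_sum_right)
qed

lemma linform_linf:
  fixes f :: "'b \<Rightarrow> 'k::field"
  shows "linform (linf f)"
  unfolding linform_iff
proof (intro conjI allI)
  fix x y :: "'b \<Rightarrow>\<^sub>0 'k"
  let ?A = "Poly_Mapping.keys x \<union> Poly_Mapping.keys y"
  show "linf f (x + y) = linf f x + linf f y"
    using Poly_Mapping.keys_add[of x y]
    by (simp add: linf_superset[of ?A] lookup_add distrib_right sum.distrib)
next
  fix c and x :: "'b \<Rightarrow>\<^sub>0 'k"
  have "Poly_Mapping.keys (smult_pm c x) \<subseteq> Poly_Mapping.keys x"
    by (auto simp: in_keys_iff)
  then show "linf f (smult_pm c x) = c * linf f x"
    by (simp add: linf_superset[of "Poly_Mapping.keys x"] sum_distrib_left mult.assoc)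
qed

lemma lin_bvec [simp]: "lin f (bvec b) = f b"
  by (simp add: lin_def)

lemma linf_bvec [simp]: "linf f (bvec b) = f b"
  by (simp add: linf_def)

text \<open>Most rules compose a linear inner map \<open>g\<close> with one operation, so that
  \<open>intro\<close> takes a nested term apart from the outside in.\<close>

named_theorems linear_intros

lemma linmap_comp: "linmap f \<Longrightarrow> linmap g \<Longrightarrow> linmap (\<lambda>x. f (g x))"
  by (simp add: linmap_iff)

lemma linmap_ident [linear_intros]: "linmap (\<lambda>x. x)"
  by (simp add: linmap_iff)

lemma linmap_lin_comp [linear_intros]: "linmap g \<Longrightarrow> linmap (\<lambda>x. lin f (g x))"
  by (rule linmap_comp[OF linmap_lin])

lemma linmap_add [linear_intros]: "linmap f \<Longrightarrow> linmap g \<Longrightarrow> linmap (\<lambda>x. f x + g x)"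
  by (simp add: linmap_iff pm.scale_right_distrib ac_simps)

lemma linmap_zero [linear_intros]: "linmap (\<lambda>x. 0)"
  by (simp add: linmap_iff)

lemma linmap_sum [linear_intros]: "(\<And>i. i \<in> A \<Longrightarrow> linmap (f i)) \<Longrightarrow> linmap (\<lambda>x. \<Sum>i\<in>A. f i x)"
  by (simp add: linmap_iff sum.distrib pm.scale_sum_right)

lemma linmap_smult [linear_intros]: "linmap f \<Longrightarrow> linmap (\<lambda>x. smult_pm c (f x))"
  unfolding linmap_iff by (metis pm.scale_left_commute pm.scale_right_distrib)

lemma linform_comp: "linform f \<Longrightarrow> linmap g \<Longrightarrow> linform (\<lambda>x. f (g x))"
  by (simp add: linmap_iff linform_iff)

lemma linform_linf_comp [linear_intros]: "linmap g \<Longrightarrow> linform (\<lambda>x. linf f (g x))"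
  by (rule linform_comp[OF linform_linf])

lemma linmap_smult_form [linear_intros]: "linform f \<Longrightarrow> linmap (\<lambda>x. smult_pm (f x) v)"
  by (simp add: linmap_iff linform_iff pm.scale_left_distrib)

lemma linform_mult_left [linear_intros]: "linform f \<Longrightarrow> linform (\<lambda>x. f x * c)"
  by (simp add: linform_iff algebra_simps)

lemma linform_mult_right [linear_intros]: "linform f \<Longrightarrow> linform (\<lambda>x. c * f x)"
  by (simp add: linform_iff algebra_simps)

lemma linmap_simps:
  assumes "linmap f"
  shows linmap_app_add: "f (x + y) = f x + f y"
    and linmap_app_smult: "f (smult_pm c x) = smult_pm c (f x)"
    and linmap_app_zero: "f 0 = 0"
    and linmap_app_sum: "f (sum h A) = (\<Sum>i\<in>A. f (h i))"
proof -
  interpret Vector_Spaces.linear smult_pm smult_pm f by fact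
  show "f (x + y) = f x + f y" "f (smult_pm c x) = smult_pm c (f x)" "f 0 = 0"
    "f (sum h A) = (\<Sum>i\<in>A. f (h i))"
    by (rule add scale zero sum)+
qed

lemma linmap_eqI: "linmap f \<Longrightarrow> linmap g \<Longrightarrow> (\<And>b. f (bvec b) = g (bvec b)) \<Longrightarrow> f x = g x"
  by (rule linear_eqI)

lemma linform_eqI: "linform f \<Longrightarrow> linform g \<Longrightarrow> (\<And>b. f (bvec b) = g (bvec b)) \<Longrightarrow> f x = g x"
  by (rule linear_eqI)

subsection \<open>Tensor products\<close>

definition bilinear :: "(('b \<Rightarrow>\<^sub>0 'k::field) \<Rightarrow> ('c \<Rightarrow>\<^sub>0 'k) \<Rightarrow> ('d \<Rightarrow>\<^sub>0 'k)) \<Rightarrow> bool" where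
  "bilinear p \<longleftrightarrow> (\<forall>y. linmap (\<lambda>x. p x y)) \<and> (\<forall>x. linmap (p x))"

lemma bilinearD1: "bilinear p \<Longrightarrow> linmap g \<Longrightarrow> linmap (\<lambda>x. p (g x) y)"
  unfolding bilinear_def by (blast intro: linmap_comp[of "\<lambda>x. p x y" for y])

lemma bilinearD2: "bilinear p \<Longrightarrow> linmap g \<Longrightarrow> linmap (\<lambda>x. p y (g x))"
  unfolding bilinear_def by (blast intro: linmap_comp)

lemma bilinear_bil: "bilinear (bil f)"
proof -
  have "linmap (\<lambda>y. lin (\<lambda>b. lin (f b) y) x)" for x
    \<comment> \<open>Only the outer \<open>lin\<close> is opened: its index set, the support of the
      fixed \<open>x\<close>, does not depend on \<open>y\<close>.\<close>
    unfolding lin_def[of _ x] by (intro linear_intros)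
  then show ?thesis
    unfolding bilinear_def bil_def by (auto intro: linear_intros)
qed

lemma bil_bvec [simp]: "bil f (bvec b) (bvec c) = f b c"
  by (simp add: bil_def)

lemma bilinear_tensor: "bilinear tensor"
  unfolding tensor_def by (simp add: bilinear_bil[unfolded bilinear_def] bilinear_def)

lemmas linmap_tensor1 [linear_intros] = bilinearD1[OF bilinear_tensor]
  and linmap_tensor2 [linear_intros] = bilinearD2[OF bilinear_tensor]

lemma tensor_bvec [simp]: "tensor (bvec b) (bvec c) = bvec (b, c)"
  by (simp add: tensor_def)

lemma bilinear_tprod: "bilinear (tprod p q)"
  unfolding tprod_def by (rule bilinear_bil)

lemmas linmap_tprod1 [linear_intros] = bilinearD1[OF bilinear_tprod]
  and linmap_tprod2 [linear_intros] = bilinearD2[OF bilinear_tprod]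

lemma linmap_tmap [linear_intros]: "linmap h \<Longrightarrow> linmap (\<lambda>x. tmap f g (h x))"
  unfolding tmap_def by (intro linear_intros)

lemma linmap_tmapf_left [linear_intros]: "linmap h \<Longrightarrow> linmap (\<lambda>x. tmapf_left f (h x))"
  unfolding tmapf_left_def by (intro linear_intros)

lemma linmap_tmapf_right [linear_intros]: "linmap h \<Longrightarrow> linmap (\<lambda>x. tmapf_right f (h x))"
  unfolding tmapf_right_def by (intro linear_intros)

lemma linmap_tassoc [linear_intros]: "linmap h \<Longrightarrow> linmap (\<lambda>x. tassoc (h x))"
  unfolding tassoc_def by (intro linear_intros)

lemma linmap_tau23 [linear_intros]: "linmap h \<Longrightarrow> linmap (\<lambda>x. tau23 (h x))"
  unfolding tau23_def by (intro linear_intros)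

lemma bilinear_linear_eqI:
  assumes "\<And>y. Vector_Spaces.linear smult_pm s (\<lambda>x. f x y)" "\<And>x. Vector_Spaces.linear smult_pm s (f x)"
    and "\<And>y. Vector_Spaces.linear smult_pm s (\<lambda>x. g x y)" "\<And>x. Vector_Spaces.linear smult_pm s (g x)"
    and "\<And>b c. f (bvec b) (bvec c) = g (bvec b) (bvec c)"
  shows "f x y = g x y"
proof (rule linear_eqI[where f = "\<lambda>x. f x y" and g = "\<lambda>x. g x y"])
  fix b show "f (bvec b) y = g (bvec b) y"
    by (rule linear_eqI[where f = "f (bvec b)" and g = "g (bvec b)"]) (fact assms)+
qed (fact assms)+

lemmas bilinear_eqI = bilinear_linear_eqI[where s = smult_pm]
  and bilinear_form_eqI = bilinear_linear_eqI[where s = "(*)"]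

text \<open>Basis vectors of the free space on pairs are pure tensors. Testing on pure tensors of
  arbitrary vectors lets the rules for \<open>tensor\<close> apply without opening a pair.\<close>

lemma tensor_eqI:
  assumes "linmap f" "linmap g" and "\<And>x y. f (tensor x y) = g (tensor x y)"
  shows "f z = g z"
proof (rule linmap_eqI[OF assms(1,2)])
  fix b show "f (bvec b) = g (bvec b)"
    using assms(3)[of "bvec (fst b)" "bvec (snd b)"] by simp
qed

lemma tmap_tensor:
  assumes "linmap f" "linmap g"
  shows "tmap f g (tensor x y) = tensor (f x) (g y)"
  by (rule bilinear_eqI[where f = "\<lambda>x y. tmap f g (tensor x y)" and g = "\<lambda>x y. tensor (f x) (g y)"])
    (intro linear_intros assms | simp add: tmap_def)+

lemma tmapf_left_tensor:
  assumes "linform f"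
  shows "tmapf_left f (tensor x y) = smult_pm (f x) y"
  by (rule bilinear_eqI[where f = "\<lambda>x y. tmapf_left f (tensor x y)" and g = "\<lambda>x y. smult_pm (f x) y"])
    (intro linear_intros assms | simp add: tmapf_left_def)+

lemma tmapf_right_tensor:
  assumes "linform f"
  shows "tmapf_right f (tensor x y) = smult_pm (f y) x"
  by (rule bilinear_eqI[where f = "\<lambda>x y. tmapf_right f (tensor x y)" and g = "\<lambda>x y. smult_pm (f y) x"])
    (intro linear_intros assms | simp add: tmapf_right_def)+

lemma tprod_tensor:
  assumes "bilinear p" "bilinear q"
  shows "tprod p q (tensor a b) (tensor c d) = tensor (p a c) (q b d)"
proof (rule bilinear_eqI[where f = "\<lambda>a b. tprod p q (tensor a b) (tensor c d)"
      and g = "\<lambda>a b. tensor (p a c) (q b d)"])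
  fix a b show "tprod p q (tensor (bvec a) (bvec b)) (tensor c d) = tensor (p (bvec a) c) (q (bvec b) d)"
    by (rule bilinear_eqI[where f = "\<lambda>c d. tprod p q (tensor (bvec a) (bvec b)) (tensor c d)"
      and g = "\<lambda>c d. tensor (p (bvec a) c) (q (bvec b) d)"])
     (intro linear_intros bilinearD1[OF assms(1)] bilinearD1[OF assms(2)]
       bilinearD2[OF assms(1)] bilinearD2[OF assms(2)] | simp add: tprod_def)+
qed (intro linear_intros bilinearD1[OF assms(1)] bilinearD1[OF assms(2)])+

lemma tassoc_tensor: "tassoc (tensor (tensor x y) z) = tensor x (tensor y z)"
proof (rule bilinear_eqI[where f = "\<lambda>x y. tassoc (tensor (tensor x y) z)" and g = "\<lambda>x y. tensor x (tensor y z)"])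
  fix b c show "tassoc (tensor (tensor (bvec b) (bvec c)) z) = tensor (bvec b) (tensor (bvec c) z)"
    by (rule linmap_eqI[where f = "\<lambda>z. tassoc (tensor (tensor (bvec b) (bvec c)) z)" and
          g = "\<lambda>z. tensor (bvec b) (tensor (bvec c) z)"])
     (intro linear_intros | simp add: tassoc_def)+
qed (intro linear_intros)+

lemma tau23_tensor: "tau23 (tensor (tensor x y) (tensor z w)) = tensor (tensor x z) (tensor y w)"
proof (rule bilinear_eqI[where f = "\<lambda>x y. tau23 (tensor (tensor x y) (tensor z w))"
      and g = "\<lambda>x y. tensor (tensor x z) (tensor y w)"])
  fix b c show "tau23 (tensor (tensor (bvec b) (bvec c)) (tensor z w))
       = tensor (tensor (bvec b) z) (tensor (bvec c) w)"
    by (rule bilinear_eqI[where f = "\<lambda>z w. tau23 (tensor (tensor (bvec b) (bvec c)) (tensor z w))" and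
          g = "\<lambda>z w. tensor (tensor (bvec b) z) (tensor (bvec c) w)"])
     (intro linear_intros | simp add: tau23_def)+
qed (intro linear_intros)+

lemma bilinear_simps:
  assumes "bilinear p"
  shows bilinear_add_left: "p (x + x') y = p x y + p x' y"
    and bilinear_add_right: "p x (y + y') = p x y + p x y'"
    and bilinear_smult_left: "p (smult_pm c x) y = smult_pm c (p x y)"
    and bilinear_smult_right: "p x (smult_pm c y) = smult_pm c (p x y)"
    and bilinear_zero_left: "p 0 y = 0"
    and bilinear_zero_right: "p x 0 = 0"
    and bilinear_sum_left: "p (sum f A) y = (\<Sum>i\<in>A. p (f i) y)"
    and bilinear_sum_right: "p x (sum g A) = (\<Sum>i\<in>A. p x (g i))"
  using linmap_simps[of "\<lambda>x. p x y"] linmap_simps[of "p x"] assms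
  unfolding bilinear_def by blast+

lemmas tensor_simps = bilinear_simps[OF bilinear_tensor]
  and tprod_simps = bilinear_simps[OF bilinear_tprod]

lemma tensor_bilinear_eqI:
  assumes "bilinear f" "bilinear g"
    and "\<And>a b c d. f (tensor a b) (tensor c d) = g (tensor a b) (tensor c d)"
  shows "f x y = g x y"
proof (rule tensor_eqI[where f = "\<lambda>x. f x y" and g = "\<lambda>x. g x y"])
  fix a b show "f (tensor a b) y = g (tensor a b) y"
    by (rule tensor_eqI[where f = "f (tensor a b)" and g = "g (tensor a b)"])
      (use assms in \<open>auto simp: bilinear_def\<close>)
qed (use assms in \<open>auto simp: bilinear_def\<close>)

lemma tmap_tmap:
  assumes "linmap f" "linmap g" "linmap h" "linmap k"
  shows "tmap f g (tmap h k x) = tmap (\<lambda>x. f (h x)) (\<lambda>x. g (k x)) x"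
  by (rule tensor_eqI[where f = "\<lambda>x. tmap f g (tmap h k x)"])
    (use assms in \<open>auto intro!: linear_intros simp: tmap_tensor linmap_comp\<close>)

text \<open>With \<open>f = eps\<close> it converts the counit identity for (\<epsilon> \<otimes>
  Id) \<Gamma> into an identity inside H \<otimes> H, as the antipode argument requires.\<close>

lemma tmap_unit_form:
  assumes "linform f" "linmap g"
  shows "tmap (\<lambda>x. smult_pm (f x) e) g x = tensor e (g (tmapf_left f x))"
  by (rule tensor_eqI[where f = "\<lambda>x. tmap (\<lambda>x. smult_pm (f x) e) g x"])
    (use assms in \<open>auto intro!: linear_intros linmap_comp[OF assms(2)] simp: tmap_tensor linear_intros tmapf_left_tensor tensor_simps linmap_app_smult\<close>)

section \<open>Commutative algebras on free spaces and their tensor products\<close>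

locale comm_algebra =
  fixes p :: "('b \<Rightarrow>\<^sub>0 'k::field) \<Rightarrow> ('b \<Rightarrow>\<^sub>0 'k) \<Rightarrow> ('b \<Rightarrow>\<^sub>0 'k)" and e :: "'b \<Rightarrow>\<^sub>0 'k"
  assumes bilinear: "bilinear p"
    and assoc: "p (p x y) z = p x (p y z)"
    and comm: "p x y = p y x"
    and unit_left [simp]: "p e x = x"
begin

lemma unit_right [simp]: "p x e = x"
  using comm unit_left by metis

lemma left_comm: "p x (p y z) = p y (p x z)"
  using assoc comm by metis

lemmas linmap_left = bilinearD1[OF bilinear]
  and linmap_right = bilinearD2[OF bilinear]

end

lemma comm_algebra_tprod:
  assumes "comm_algebra p e" "comm_algebra q f"
  shows "comm_algebra (tprod p q) (tensor e f)"
proof -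
  interpret P: comm_algebra p e by fact
  interpret Q: comm_algebra q f by fact
  note [simp] = tprod_tensor[OF P.bilinear Q.bilinear]
  show ?thesis
  proof
    show "bilinear (tprod p q)" by (rule bilinear_tprod)
  next
    fix x y z
    show "tprod p q (tprod p q x y) z = tprod p q x (tprod p q y z)"
    proof (rule tensor_eqI[where f = "\<lambda>z. tprod p q (tprod p q x y) z"])
      fix a b
      show "tprod p q (tprod p q x y) (tensor a b) = tprod p q x (tprod p q y (tensor a b))"
        by (rule tensor_bilinear_eqI[where f = "\<lambda>x y. tprod p q (tprod p q x y) (tensor a b)"
              and g = "\<lambda>x y. tprod p q x (tprod p q y (tensor a b))"])
          (auto simp: bilinear_def P.assoc Q.assoc intro!: linear_intros)
    qed (intro linear_intros)+
  next
    fix x y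
    show "tprod p q x y = tprod p q y x"
      by (rule tensor_bilinear_eqI[where g = "\<lambda>x y. tprod p q y x"])
          (auto simp: bilinear_def P.comm Q.comm intro!: linear_intros)
  next
    fix x
    show "tprod p q (tensor e f) x = x"
      by (rule tensor_eqI[where f = "\<lambda>x. tprod p q (tensor e f) x"]) (auto intro!: linear_intros)
  qed
qed

lemma alg_hom_tmap:
  assumes "bilinear p" "bilinear q" "bilinear p'" "bilinear q'" "linmap f" "linmap g"
    and "alg_hom p e p' e' f" "alg_hom q d q' d' g"
  shows "alg_hom (tprod p q) (tensor e d) (tprod p' q') (tensor e' d') (tmap f g)"
  unfolding alg_hom_def
proof (intro conjI allI)
  fix x y
  show "tmap f g (tprod p q x y) = tprod p' q' (tmap f g x) (tmap f g y)"
    by (rule tensor_bilinear_eqI[where f = "\<lambda>x y. tmap f g (tprod p q x y)"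
          and g = "\<lambda>x y. tprod p' q' (tmap f g x) (tmap f g y)"])
       (use assms in \<open>auto simp: alg_hom_def tmap_tensor tprod_tensor
          simp: bilinear_def[of "\<lambda>x y. tmap f g (tprod p q x y)"] bilinear_def[of "\<lambda>x y. tprod p' q' (tmap f g x) (tmap f g y)"]
          intro!: linear_intros\<close>)
qed (use assms in \<open>auto simp: alg_hom_def tmap_tensor\<close>)

lemma alg_hom_ident: "alg_hom p e p e (\<lambda>x. x)"
  by (simp add: alg_hom_def)

subsection \<open>The quasi-shuffle algebra\<close>

lemma bilinear_star: "bilinear star"
  unfolding star_def by (rule bilinear_bil)

lemmas linmap_star1 [linear_intros] = bilinearD1[OF bilinear_star]
  and linmap_star2 [linear_intros] = bilinearD2[OF bilinear_star]
  and star_simps = bilinear_simps[OF bilinear_star]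

lemma star_bvec: "star (bvec u) (bvec v) = qsh u v"
  by (simp add: star_def)

lemma linmap_cons_lin [linear_intros]: "linmap g \<Longrightarrow> linmap (\<lambda>x. cons_lin a (g x))"
  unfolding cons_lin_def by (intro linear_intros)

lemma cons_lin_bvec [simp]: "cons_lin a (bvec w) = bvec (a # w)"
  by (simp add: cons_lin_def)

lemmas cons_lin_simps = linmap_simps[OF linmap_cons_lin[OF linmap_ident]]

lemma qsh_Nil2 [simp]: "qsh u [] = bvec u"
  by (cases u) auto

lemma star_one_left [simp]: "star one_H x = x"
  by (rule linmap_eqI[where f = "\<lambda>x. star one_H x"]) (auto intro!: linear_intros simp: star_bvec)

text \<open>The recursion of \<open>qsh\<close> in bilinear form: \<open>x\<close> and
  \<open>y\<close> may be arbitrary vectors, so it can be applied again to the products it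
  creates.\<close>

lemma star_cons_cons:
  "star (cons_lin a x) (cons_lin b y) =
    cons_lin a (star x (cons_lin b y)) + cons_lin b (star (cons_lin a x) y) + cons_lin (a + b) (star x y)"
  by (rule bilinear_eqI[where f = "\<lambda>x y. star (cons_lin a x) (cons_lin b y)" and
       g = "\<lambda>x y. cons_lin a (star x (cons_lin b y)) + cons_lin b (star (cons_lin a x) y) + cons_lin (a + b) (star x y)"])
     (intro linear_intros | simp add: star_bvec)+

lemma qsh_commute: "qsh u v = qsh v u"
  by (induction u v rule: qsh.induct) (simp_all add: add.commute ac_simps)

lemma star_commute: "star x y = star y x"
  by (rule bilinear_eqI[where f = "\<lambda>x y. star x y" and g = "\<lambda>x y. star y x"])
     (intro linear_intros | simp add: star_bvec qsh_commute)+

text \<open>Either bracketing of a product of three nonempty words expands into seven terms, one for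
  each nonempty set of the words whose first letters are added to form the leading letter. The
  remainders agree by induction on the total length.\<close>

lemma star_assoc_bvec:
  fixes u v w :: "'a::ab_semigroup_add list"
  shows "star (star (bvec u) (bvec v)) (bvec w :: 'a list \<Rightarrow>\<^sub>0 'k::field) = star (bvec u) (star (bvec v) (bvec w))"
proof (induction "length u + length v + length w" arbitrary: u v w rule: less_induct)
  case less
  show ?case
  proof (cases "u = [] \<or> v = [] \<or> w = []")
    case True
    then show ?thesis using star_one_left star_commute by metis
  next
    case False
    then obtain a u' b v' c w' where eq: "u = a # u'" "v = b # v'" "w = c # w'"
      by (meson neq_Nil_conv)
    note IH = less[unfolded eq, simplified]
    \<comment> \<open>Opaque names keep \<open>cons_lin_bvec\<close> from absorbing the leading
      letters, so \<open>star_cons_cons\<close> stays applicable.\<close>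
    define x y z :: "'a list \<Rightarrow>\<^sub>0 'k" where "x = bvec u'" and "y = bvec v'" and "z = bvec w'"
    let ?x = "cons_lin a x" and ?y = "cons_lin b y" and ?z = "cons_lin c z"
    have IHs: "star (star x ?y) ?z = star x (star ?y ?z)" "star (star ?x y) ?z = star ?x (star y ?z)"
      "star (star x y) ?z = star x (star y ?z)" "star (star ?x ?y) z = star ?x (star ?y z)"
      "star (star x ?y) z = star x (star ?y z)" "star (star ?x y) z = star ?x (star y z)"
      "star (star x y) z = star x (star y z)"
      unfolding x_def y_def z_def cons_lin_bvec by (rule IH; simp)+
    have 1: "star (star ?x ?y) ?z = cons_lin a (star (star x ?y) ?z) + cons_lin b (star (star ?x y) ?z)
        + cons_lin (a + b) (star (star x y) ?z) + cons_lin c (star (star ?x ?y) z)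
        + cons_lin (a + c) (star (star x ?y) z) + cons_lin (b + c) (star (star ?x y) z)
        + cons_lin (a + b + c) (star (star x y) z)"
      by (simp add: star_cons_cons star_simps cons_lin_simps ac_simps)
    have 2: "star ?x (star ?y ?z) = cons_lin a (star x (star ?y ?z)) + cons_lin b (star ?x (star y ?z))
        + cons_lin (a + b) (star x (star y ?z)) + cons_lin c (star ?x (star ?y z))
        + cons_lin (a + c) (star x (star ?y z)) + cons_lin (b + c) (star ?x (star y z))
        + cons_lin (a + b + c) (star x (star y z))"
      by (simp add: star_cons_cons star_simps cons_lin_simps ac_simps)
    have "star (star ?x ?y) ?z = star ?x (star ?y ?z)"
      unfolding 1 2 IHs ..
    then show ?thesis by (simp add: eq x_def y_def z_def)
  qed
qed

lemma star_assoc: "star (star x y) z = star x (star y z)"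
proof (rule linmap_eqI[where f = "\<lambda>z. star (star x y) z"])
  fix w show "star (star x y) (bvec w) = star x (star y (bvec w))"
    by (rule bilinear_eqI[where f = "\<lambda>x y. star (star x y) (bvec w)"
          and g = "\<lambda>x y. star x (star y (bvec w))"])
     (intro linear_intros | simp add: star_assoc_bvec)+
qed (intro linear_intros)+

interpretation star: comm_algebra "star :: ('a::ab_semigroup_add list \<Rightarrow>\<^sub>0 'k::field) \<Rightarrow> _" one_H
  by standard (rule bilinear_star star_assoc star_commute star_one_left)+

interpretation star2: comm_algebra "star2 :: ('a::ab_semigroup_add list \<times> 'b::ab_semigroup_add list \<Rightarrow>\<^sub>0 'k::field) \<Rightarrow> _"
    "bvec ([], [])"
  using comm_algebra_tprod[OF star.comm_algebra_axioms star.comm_algebra_axioms] by simp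

section \<open>The action of a letter and an algebra element on H \<otimes> A\<close>

context comm_algebra
begin

text \<open>The component \<open>r\<close> is any vector, not just a basis element: products such as
  \<open>p r s\<close> and coproducts \<open>Gamma u\<close> will take its place.\<close>

definition tcons :: "'a::ab_semigroup_add \<Rightarrow> ('b \<Rightarrow>\<^sub>0 'k) \<Rightarrow> ('a list \<times> 'b \<Rightarrow>\<^sub>0 'k) \<Rightarrow> ('a list \<times> 'b \<Rightarrow>\<^sub>0 'k)" where
  "tcons a r = tmap (cons_lin a) (p r)"

lemma linmap_tcons: "linmap g \<Longrightarrow> linmap (\<lambda>x. tcons a r (g x))"
  unfolding tcons_def by (intro linear_intros)

lemma tcons_tensor: "tcons a r (tensor x y) = tensor (cons_lin a x) (p r y)"
  unfolding tcons_def by (intro tmap_tensor linear_intros linmap_right)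

lemma linmap_tcons_left: "linmap g \<Longrightarrow> linmap (\<lambda>r. tcons a (g r) z)"
proof -
  have "linmap (\<lambda>r. tcons a r z)"
    unfolding tcons_def tmap_def lin_def
    by (auto simp: case_prod_unfold intro!: linear_intros linmap_left)
  then show "linmap g \<Longrightarrow> linmap (\<lambda>r. tcons a (g r) z)"
    by (rule linmap_comp)
qed

lemma tcons_unit_tensor: "tcons a e (tensor x y) = tensor (cons_lin a x) y"
  by (simp add: tcons_tensor)

lemmas tprod_star_tensor = tprod_tensor[OF bilinear_star bilinear]

text \<open>On pure tensors the first factors obey \<open>star_cons_cons\<close>. The second factor
  is the same product of four elements in every term, up to an order that associativity and
  commutativity of \<open>p\<close> restore.\<close>

lemma tprod_tcons_tcons:
  "tprod star p (tcons a r x) (tcons b s y) =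
    tcons a r (tprod star p x (tcons b s y)) + tcons b s (tprod star p (tcons a r x) y)
      + tcons (a + b) (p r s) (tprod star p x y)"
proof (rule tensor_bilinear_eqI[where f = "\<lambda>x y. tprod star p (tcons a r x) (tcons b s y)"
   and g = "\<lambda>x y. tcons a r (tprod star p x (tcons b s y)) + tcons b s (tprod star p (tcons a r x) y)
      + tcons (a + b) (p r s) (tprod star p x y)"])
  fix x y z w
  show "tprod star p (tcons a r (tensor x y)) (tcons b s (tensor z w)) =
    tcons a r (tprod star p (tensor x y) (tcons b s (tensor z w))) + tcons b s (tprod star p (tcons a r (tensor x y)) (tensor z w))
      + tcons (a + b) (p r s) (tprod star p (tensor x y) (tensor z w))"
    by (simp add: tcons_tensor tprod_star_tensor star_cons_cons tensor_simps assoc left_comm[of y] left_comm[of s r])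
qed (auto simp: bilinear_def intro!: linear_intros linmap_tcons)

lemma tprod_tcons_tensor_one:
  "tprod star p (tcons a r x) (tensor one_H q) = tcons a r (tprod star p x (tensor one_H q))"
  by (rule tensor_eqI[where f = "\<lambda>x. tprod star p (tcons a r x) (tensor one_H q)"])
     (auto simp: tcons_tensor tprod_star_tensor assoc intro!: linear_intros linmap_tcons)

end

lemmas tcons_intros [linear_intros] =
  star.linmap_tcons star.linmap_tcons_left star2.linmap_tcons star2.linmap_tcons_left

lemmas tcons_simps = linmap_simps[OF star.linmap_tcons[OF linmap_ident]]

subsection \<open>Deconcatenation\<close>

lemma linmap_Delta [linear_intros]: "linmap g \<Longrightarrow> linmap (\<lambda>x. Delta (g x))"
  unfolding Delta_def by (intro linear_intros)

lemmas Delta_simps = linmap_simps[OF linmap_Delta[OF linmap_ident]]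

lemma Delta_bvec: "Delta (bvec w) = (\<Sum>i\<le>length w. tensor (bvec (take i w)) (bvec (drop i w)))"
  by (simp add: Delta_def atMost_atLeast0)

lemma Delta_Nil [simp]: "Delta one_H = bvec ([], [])"
  by (simp add: Delta_bvec)

text \<open>The cut in front of \<open>a\<close> gives the first summand; any other cut leaves
  \<open>a\<close> at the head of the left part. Thus \<Delta> is also governed by
  \<open>tcons\<close>, with the unit as algebra element.\<close>

lemma Delta_cons_lin:
  "Delta (cons_lin a x) = tensor one_H (cons_lin a x) + star.tcons a one_H (Delta x)"
proof (rule linmap_eqI[where f = "\<lambda>x. Delta (cons_lin a x)"])
  fix w
  show "Delta (cons_lin a (bvec w)) = tensor one_H (cons_lin a (bvec w)) + star.tcons a one_H (Delta (bvec w))"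
    unfolding Delta_bvec cons_lin_bvec
    by (simp add: sum.atMost_Suc_shift tcons_simps star.tcons_unit_tensor del: sum.atMost_Suc tensor_bvec)
qed (intro linear_intros)+

lemma Delta_star:
  fixes x y :: "'a::ab_semigroup_add list \<Rightarrow>\<^sub>0 'k::field"
  shows "Delta (star x y) = star2 (Delta x) (Delta y)"
proof (rule bilinear_eqI[where f = "\<lambda>x y. Delta (star x y)" and g = "\<lambda>x y. star2 (Delta x) (Delta y)"])
  fix u v :: "'a list"
  show "Delta (star (bvec u) (bvec v) :: 'a list \<Rightarrow>\<^sub>0 'k) = star2 (Delta (bvec u)) (Delta (bvec v))"
  proof (induction u v rule: qsh.induct)
    case (3 a u b v)
    define x y :: "'a list \<Rightarrow>\<^sub>0 'k" where "x = bvec u" and "y = bvec v"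
    let ?x = "cons_lin a x" and ?y = "cons_lin b y"
    have IH: "Delta (star x ?y) = star2 (Delta x) (Delta ?y)"
      "Delta (star ?x y) = star2 (Delta ?x) (Delta y)"
      "Delta (star x y) = star2 (Delta x) (Delta y)"
      using 3 by (simp_all add: x_def y_def)
    let ?X = "star.tcons a one_H (Delta x)" and ?Y = "star.tcons b one_H (Delta y)"
    have "Delta (star ?x ?y) = tensor one_H (star ?x ?y)
       + (star.tcons a one_H (star2 (Delta x) (Delta ?y)) + star.tcons b one_H (star2 (Delta ?x) (Delta y))
       + star.tcons (a + b) one_H (star2 (Delta x) (Delta y)))"
      unfolding IH[symmetric]
      by (simp only: star_cons_cons Delta_simps Delta_cons_lin[of _ "star _ _"] tensor_simps ac_simps)
    \<comment> \<open>Each remaining full coproduct splits by \<open>Delta_cons_lin\<close>. The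
      parts with a unit in the first factor give the two mixed products, the others assemble into
      \<open>star2 ?X ?Y\<close> by the three-term rule.\<close>
    also have "\<dots> = tensor one_H (star ?x ?y) + star2 ?X (tensor one_H ?y) + star2 (tensor one_H ?x) ?Y
        + star2 ?X ?Y"
      unfolding star.tprod_tcons_tcons Delta_cons_lin
      by (simp add: star.tprod_tcons_tensor_one star2.comm[of "tensor one_H _"] tprod_simps tcons_simps ac_simps)
    also have "\<dots> = star2 (Delta ?x) (Delta ?y)"
      by (simp add: Delta_cons_lin tprod_simps star.tprod_star_tensor ac_simps)
    finally show ?case by (simp add: x_def y_def)
  qed simp_all
qed (intro linear_intros)+

lemma Delta_apply:
  assumes "linmap f"
  shows "f (Delta (bvec w)) = (\<Sum>i\<le>length w. f (tensor (bvec (take i w)) (bvec (drop i w))))"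
  by (simp add: Delta_bvec linmap_app_sum[OF assms] del: tensor_bvec)

lemma sum_atMost_split0: "(\<Sum>i\<le>n. f i) = f 0 + (\<Sum>i\<in>{0<..n}. f i)" for f :: "nat \<Rightarrow> 'b::comm_monoid_add"
proof -
  have "{..n} = insert 0 {0<..n}" by auto
  then show ?thesis by simp
qed

subsection \<open>Weights and counits on products of words\<close>

lemma linform_eps [linear_intros]: "linmap g \<Longrightarrow> linform (\<lambda>x. eps (g x))"
  unfolding eps_def by (intro linear_intros)

lemma eps_bvec: "eps (bvec w) = (if w = [] then 1 else 0)"
  by (simp add: eps_def)

text \<open>Agreement is asked on the support of \<open>x\<close> only, since the weight is under
  control only for the words occurring in a product.\<close>

lemma linear_eq_on_keys:
  assumes "linmap f" "linmap g"
    and "\<And>b. b \<in> Poly_Mapping.keys x \<Longrightarrow> f (bvec b) = g (bvec b)"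
  shows "f x = g x"
  using linear_basis_expansion[OF assms(1), of x] linear_basis_expansion[OF assms(2), of x] assms(3)
  by simp

lemma keys_cons_lin: "Poly_Mapping.keys (cons_lin a x) \<subseteq> (#) a ` Poly_Mapping.keys x"
proof -
  have "cons_lin a x = (\<Sum>b\<in>Poly_Mapping.keys x. Poly_Mapping.single (a # b) (Poly_Mapping.lookup x b))"
    unfolding cons_lin_def lin_def
    by (rule sum.cong[OF refl], rule poly_mapping_eqI) (simp add: lookup_single when_def)
  then show ?thesis
    using keys_sum[of "\<lambda>b. Poly_Mapping.single (a # b) (Poly_Mapping.lookup x b)" "Poly_Mapping.keys x"]
    by (auto split: if_splits)
qed

lemma weight_Cons: "w \<noteq> [] \<Longrightarrow> weight (a # w) = a + weight w"
  by (cases w) auto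

lemma weight_append: "u \<noteq> [] \<Longrightarrow> v \<noteq> [] \<Longrightarrow> weight (u @ v) = weight u + weight v"
  by (induction u rule: weight.induct) (auto simp: weight_Cons ac_simps)

lemma keys_add3:
  fixes x y z :: "'b \<Rightarrow>\<^sub>0 'k::field"
  shows "Poly_Mapping.keys (x + y + z) \<subseteq> Poly_Mapping.keys x \<union> Poly_Mapping.keys y \<union> Poly_Mapping.keys z"
  by (rule order_trans[OF Poly_Mapping.keys_add Un_mono[OF Poly_Mapping.keys_add order_refl]])

lemma keys_qsh_Cons:
  assumes "w \<in> Poly_Mapping.keys (qsh (a # u) (b # v) :: 'a::ab_semigroup_add list \<Rightarrow>\<^sub>0 'k::field)"
  obtains w' where "w = a # w'" "w' \<in> Poly_Mapping.keys (qsh u (b # v) :: 'a list \<Rightarrow>\<^sub>0 'k)"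
    | w' where "w = b # w'" "w' \<in> Poly_Mapping.keys (qsh (a # u) v :: 'a list \<Rightarrow>\<^sub>0 'k)"
    | w' where "w = (a + b) # w'" "w' \<in> Poly_Mapping.keys (qsh u v :: 'a list \<Rightarrow>\<^sub>0 'k)"
proof -
  have "w \<in> Poly_Mapping.keys (cons_lin a (qsh u (b # v)) :: 'a list \<Rightarrow>\<^sub>0 'k) \<union> Poly_Mapping.keys (cons_lin b (qsh (a # u) v) :: 'a list \<Rightarrow>\<^sub>0 'k)
      \<union> Poly_Mapping.keys (cons_lin (a + b) (qsh u v) :: 'a list \<Rightarrow>\<^sub>0 'k)"
    using subsetD[OF keys_add3] assms unfolding qsh.simps .
  then show thesis
  proof (elim UnE)
    assume "w \<in> Poly_Mapping.keys (cons_lin a (qsh u (b # v)) :: 'a list \<Rightarrow>\<^sub>0 'k)"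
    from subsetD[OF keys_cons_lin this] show thesis by (rule imageE) (rule that(1))
  next
    assume "w \<in> Poly_Mapping.keys (cons_lin b (qsh (a # u) v) :: 'a list \<Rightarrow>\<^sub>0 'k)"
    from subsetD[OF keys_cons_lin this] show thesis by (rule imageE) (rule that(2))
  next
    assume "w \<in> Poly_Mapping.keys (cons_lin (a + b) (qsh u v) :: 'a list \<Rightarrow>\<^sub>0 'k)"
    from subsetD[OF keys_cons_lin this] show thesis by (rule imageE) (rule that(3))
  qed
qed

text \<open>Every letter of \<open>u\<close> and \<open>v\<close> enters exactly one letter of
  \<open>w\<close>, alone or in a sum, so the total is kept. The length bounds exclude the empty
  word, whose weight is unspecified.\<close>

lemma keys_qsh:
  assumes "w \<in> Poly_Mapping.keys (qsh u v :: 'a::ab_semigroup_add list \<Rightarrow>\<^sub>0 'k::field)"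
  shows "length u \<le> length w" "length v \<le> length w"
    and "u \<noteq> [] \<Longrightarrow> v \<noteq> [] \<Longrightarrow> weight w = weight u + weight v"
proof -
  have "length u \<le> length w \<and> length v \<le> length w \<and>
      (u \<noteq> [] \<longrightarrow> v \<noteq> [] \<longrightarrow> weight w = weight u + weight v)"
    using assms
  proof (induction u v arbitrary: w rule: qsh.induct)
    case (3 a u b v)
    from 3(4) consider
        w' where "w = a # w'" "w' \<in> Poly_Mapping.keys (qsh u (b # v) :: 'a list \<Rightarrow>\<^sub>0 'k)"
      | w' where "w = b # w'" "w' \<in> Poly_Mapping.keys (qsh (a # u) v :: 'a list \<Rightarrow>\<^sub>0 'k)"
      | w' where "w = (a + b) # w'" "w' \<in> Poly_Mapping.keys (qsh u v :: 'a list \<Rightarrow>\<^sub>0 'k)"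
      by (rule keys_qsh_Cons)
    then show ?case
    proof cases
      case 1
      with 3(1)[OF 1(2)] show ?thesis
        \<comment> \<open>For an empty remainder the weight part of the induction hypothesis is
          void, but then the product is a single known word.\<close>
        by (cases "u = []"; cases w') (auto simp: weight_Cons ac_simps)
    next
      case 2
      with 3(2)[OF 2(2)] show ?thesis
        by (cases "v = []"; cases w') (auto simp: weight_Cons ac_simps)
    next
      case 3
      with "3.IH"(3)[OF 3(2)] show ?thesis
        by (cases "u = []"; cases "v = []"; cases w') (auto simp: weight_Cons ac_simps)
    qed
  qed auto
  then show "length u \<le> length w" "length v \<le> length w"
    "u \<noteq> [] \<Longrightarrow> v \<noteq> [] \<Longrightarrow> weight w = weight u + weight v"
    by auto
qed

lemma eps_star:
  fixes x y :: "'a::ab_semigroup_add list \<Rightarrow>\<^sub>0 'k::field"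
  shows "eps (star x y) = eps x * eps y"
proof (rule bilinear_form_eqI[where f = "\<lambda>x y. eps (star x y)" and g = "\<lambda>x y. eps x * eps y"])
  fix u v :: "'a list"
  show "eps (star (bvec u) (bvec v) :: 'a list \<Rightarrow>\<^sub>0 'k) = eps (bvec u) * eps (bvec v)"
  proof (cases "u = [] \<or> v = []")
    case True then show ?thesis by (auto simp: eps_bvec)
  next
    case False
    have "w \<noteq> []" if "w \<in> Poly_Mapping.keys (qsh u v :: 'a list \<Rightarrow>\<^sub>0 'k)" for w
      using keys_qsh(1)[OF that] False by auto
    then have "linf (\<lambda>w. if w = [] then 1 else 0) (qsh u v :: 'a list \<Rightarrow>\<^sub>0 'k) = 0"
      unfolding linf_def by (intro sum.neutral) auto
    then show ?thesis using False by (simp add: star_bvec eps_def)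
  qed
qed (intro linear_intros)+

lemma eps_cons_lin: "eps (cons_lin a x) = 0"
  by (rule linform_eqI[where f = "\<lambda>x. eps (cons_lin a x)"])
     (intro linear_intros | simp add: eps_bvec linform_iff)+

lemma linform_eps_Gamma [linear_intros]: "linmap g \<Longrightarrow> linform (\<lambda>x. eps_Gamma (g x))"
  unfolding eps_Gamma_def by (intro linear_intros)

lemma eps_Gamma_bvec: "eps_Gamma (bvec w) = (if length w \<le> 1 then 1 else 0)"
  by (simp add: eps_Gamma_def)

lemma eps_Gamma_cons_lin: "eps_Gamma (cons_lin a x) = eps x"
  by (rule linform_eqI[where f = "\<lambda>x. eps_Gamma (cons_lin a x)"])
     (intro linear_intros | simp add: eps_bvec eps_Gamma_bvec)+

lemma linform_app_add: "linform f \<Longrightarrow> f (x + y) = f x + f y"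
  by (simp add: linform_iff)

text \<open>On a word with a leading letter \<open>eps_Gamma\<close> is \<open>eps\<close> of the
  rest. So among the three terms for nonempty words only the one that merges both leading letters
  can survive, and it does exactly when both words are letters.\<close>

lemma eps_Gamma_star:
  fixes x y :: "'a::ab_semigroup_add list \<Rightarrow>\<^sub>0 'k::field"
  shows "eps_Gamma (star x y) = eps_Gamma x * eps_Gamma y"
proof (rule bilinear_form_eqI[where f = "\<lambda>x y. eps_Gamma (star x y)" and g = "\<lambda>x y. eps_Gamma x * eps_Gamma y"])
  fix u v :: "'a list"
  show "eps_Gamma (star (bvec u) (bvec v) :: 'a list \<Rightarrow>\<^sub>0 'k) = eps_Gamma (bvec u) * eps_Gamma (bvec v)"
  proof (cases "u = [] \<or> v = []")
    case True then show ?thesis by (auto simp: eps_Gamma_bvec)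
  next
    case False
    then obtain a u' b v' where "u = a # u'" "v = b # v'" by (meson neq_Nil_conv)
    then have eq: "(bvec u :: 'a list \<Rightarrow>\<^sub>0 'k) = cons_lin a (bvec u')"
        "(bvec v :: 'a list \<Rightarrow>\<^sub>0 'k) = cons_lin b (bvec v')"
      by simp_all
    show ?thesis
      unfolding eq star_cons_cons linform_app_add[OF linform_eps_Gamma[OF linmap_ident]]
        eps_Gamma_cons_lin eps_star
      by (simp add: eps_bvec)
  qed
qed (intro linear_intros)+

subsection \<open>The decomposition coproduct\<close>

text \<open>Unlike \<open>decomps\<close>, this admits the empty list of pieces for the empty word,
  so \<open>Gamma\<close> has one formula for all words and the recursion on the first piece ends
  properly.\<close>

definition compositions :: "'a list \<Rightarrow> 'a list list set" where
  "compositions w = {ws. concat ws = w \<and> (\<forall>u\<in>set ws. u \<noteq> [])}"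

lemma compositions_Nil [simp]: "compositions [] = {[]}"
proof -
  have "ws = []" if "concat ws = []" "\<forall>u\<in>set ws. u \<noteq> []" for ws :: "'a list list"
    using that by (cases ws) auto
  then show ?thesis by (auto simp: compositions_def)
qed

lemma compositions_rec:
  assumes "w \<noteq> []"
  shows "compositions w = (\<Union>i\<in>{0<..length w}. (#) (take i w) ` compositions (drop i w))"
proof (intro set_eqI iffI)
  fix ws assume ws: "ws \<in> compositions w"
  then obtain u vs where eq: "ws = u # vs"
    using assms by (cases ws) (auto simp: compositions_def)
  with ws have "u \<noteq> []" "w = u @ concat vs" "vs \<in> compositions (concat vs)"
    by (auto simp: compositions_def)
  then show "ws \<in> (\<Union>i\<in>{0<..length w}. (#) (take i w) ` compositions (drop i w))"
    by (intro UN_I[of "length u"]) (auto simp: eq)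
next
  fix ws assume "ws \<in> (\<Union>i\<in>{0<..length w}. (#) (take i w) ` compositions (drop i w))"
  then show "ws \<in> compositions w"
    by (auto simp: compositions_def)
qed

lemma finite_compositions: "finite (compositions w)"
proof (induction "length w" arbitrary: w rule: less_induct)
  case less
  show ?case
  proof (cases "w = []")
    case False
    have "finite (compositions (drop i w))" if "i \<in> {0<..length w}" for i
      using less[of "drop i w"] that False by auto
    then show ?thesis unfolding compositions_rec[OF False] by blast
  qed simp
qed

lemma Gamma_bvec:
  "Gamma (bvec w) = (\<Sum>ws\<in>compositions w.
    tensor (bvec (map weight ws)) (List.foldr star (map bvec ws) one_H))"
proof (cases "w = []")
  case False
  then have "decomps w = compositions w" by (auto simp: decomps_def compositions_def)
  then show ?thesis using False by (simp add: Gamma_def Gamma_w_def)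
qed (simp add: Gamma_def Gamma_w_def)

lemma linmap_Gamma [linear_intros]: "linmap g \<Longrightarrow> linmap (\<lambda>x. Gamma (g x))"
  unfolding Gamma_def by (intro linear_intros)

lemmas Gamma_simps = linmap_simps[OF linmap_Gamma[OF linmap_ident]]

lemma Gamma_one [simp]: "Gamma one_H = bvec ([], [])"
  by (simp add: Gamma_bvec)

lemma Gamma_rec:
  fixes w :: "'a::ab_semigroup_add list"
  assumes "w \<noteq> []"
  shows "Gamma (bvec w :: 'a list \<Rightarrow>\<^sub>0 'k::field) = (\<Sum>i\<in>{0<..length w}.
    star.tcons (weight (take i w)) (bvec (take i w)) (Gamma (bvec (drop i w))))"
proof -
  let ?t = "\<lambda>ws. tensor (bvec (map weight ws)) (List.foldr star (map bvec ws) one_H) :: ('a list \<times> 'a list) \<Rightarrow>\<^sub>0 'k"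
  have "Gamma (bvec w) = (\<Sum>i\<in>{0<..length w}. \<Sum>ws\<in>(#) (take i w) ` compositions (drop i w). ?t ws)"
    unfolding Gamma_bvec compositions_rec[OF assms]
  proof (rule sum.UNION_disjoint)
    show "\<forall>i\<in>{0<..length w}. finite ((#) (take i w) ` compositions (drop i w))"
      by (simp add: finite_compositions)
    \<comment> \<open>The length of the first piece determines the cut, so the classes of
      decompositions are disjoint.\<close>
    have "take i w \<noteq> take j w" if "i \<in> {0<..length w}" "j \<in> {0<..length w}" "i \<noteq> j" for i j
    proof
      assume "take i w = take j w"
      then have "length (take i w) = length (take j w)" by simp
      with that show False by simp
    qed
    then show "\<forall>i\<in>{0<..length w}. \<forall>j\<in>{0<..length w}. i \<noteq> j \<longrightarrow>
        (#) (take i w) ` compositions (drop i w) \<inter> (#) (take j w) ` compositions (drop j w) = {}"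
      by blast
  qed simp
  also have "\<dots> = (\<Sum>i\<in>{0<..length w}. star.tcons (weight (take i w)) (bvec (take i w)) (Gamma (bvec (drop i w))))"
    by (rule sum.cong[OF refl])
      (simp add: Gamma_bvec sum.reindex tcons_simps star.tcons_tensor)
  finally show ?thesis .
qed

section \<open>The recursion for \<Gamma> as an identity of linear maps\<close>

text \<open>With the extension \<open>theta_lin\<close> below, \<open>\<Gamma> = \<epsilon> \<one> + theta_lin (Id \<otimes> \<Gamma>) \<Delta>\<close>.\<close>

definition theta :: "('a::ab_semigroup_add list \<Rightarrow>\<^sub>0 'k::field) \<Rightarrow> ('a list \<times> 'a list \<Rightarrow>\<^sub>0 'k) \<Rightarrow> ('a list \<times> 'a list \<Rightarrow>\<^sub>0 'k)" where
  "theta = bil (\<lambda>u z. if u = [] then 0 else star.tcons (weight u) (bvec u) (bvec z))"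

lemma bilinear_theta: "bilinear theta"
  unfolding theta_def by (rule bilinear_bil)

lemmas linmap_theta1 [linear_intros] = bilinearD1[OF bilinear_theta]
  and linmap_theta2 [linear_intros] = bilinearD2[OF bilinear_theta]

lemma theta_bvec: "theta (bvec u) z = (if u = [] then 0 else star.tcons (weight u) (bvec u) z)"
  by (cases "u = []"; rule linmap_eqI[where f = "theta (bvec u)"])
    (intro linear_intros | simp add: theta_def)+

definition theta_lin :: "('a::ab_semigroup_add list \<times> ('a list \<times> 'a list) \<Rightarrow>\<^sub>0 'k::field) \<Rightarrow> ('a list \<times> 'a list \<Rightarrow>\<^sub>0 'k)" where
  "theta_lin = lin (\<lambda>(u, z). theta (bvec u) (bvec z))"

lemma linmap_theta_lin [linear_intros]: "linmap g \<Longrightarrow> linmap (\<lambda>x. theta_lin (g x))"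
  unfolding theta_lin_def by (intro linear_intros)

lemma theta_lin_tensor: "theta_lin (tensor x z) = theta x z"
  by (rule bilinear_eqI[where f = "\<lambda>x z. theta_lin (tensor x z)"])
    (intro linear_intros | simp add: theta_lin_def)+

text \<open>As \<open>theta\<close> kills the empty prefix, the value at the empty word has to come
  from the counit term. Being linear in \<open>x\<close>, the identity can be used at a product of
  words.\<close>

lemma Gamma_Delta:
  fixes x :: "'a::ab_semigroup_add list \<Rightarrow>\<^sub>0 'k::field"
  shows "Gamma x = smult_pm (eps x) (bvec ([], [])) + theta_lin (tmap (\<lambda>x. x) Gamma (Delta x))"
proof (rule linmap_eqI[where f = Gamma])
  fix w :: "'a list"
  have "theta_lin (tmap (\<lambda>x. x) Gamma (Delta (bvec w :: 'a list \<Rightarrow>\<^sub>0 'k))) =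
     (\<Sum>i\<le>length w. theta (bvec (take i w)) (Gamma (bvec (drop i w))))"
    by (subst Delta_apply[of "\<lambda>x. theta_lin (tmap (\<lambda>x. x) Gamma x)"])
      (auto intro!: linear_intros simp: tmap_tensor theta_lin_tensor linear_intros simp del: tensor_bvec)
  also have "\<dots> = (\<Sum>i\<in>{0<..length w}.
    star.tcons (weight (take i w)) (bvec (take i w)) (Gamma (bvec (drop i w))))"
    unfolding sum_atMost_split0 by (auto simp: theta_bvec intro!: sum.cong)
  finally show "Gamma (bvec w :: 'a list \<Rightarrow>\<^sub>0 'k) = smult_pm (eps (bvec w)) (bvec ([], [])) + theta_lin (tmap (\<lambda>x. x) Gamma (Delta (bvec w)))"
    by (cases "w = []") (simp_all add: Gamma_rec eps_bvec)
qed (intro linear_intros)+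

lemma theta_star:
  fixes u v :: "'a::ab_semigroup_add list" and z :: "'a list \<times> 'a list \<Rightarrow>\<^sub>0 'k::field"
  assumes "u \<noteq> []" "v \<noteq> []"
  shows "theta (star (bvec u) (bvec v)) z = star.tcons (weight u + weight v) (star (bvec u) (bvec v)) z"
  unfolding star_bvec
proof (rule linear_eq_on_keys[where f = "\<lambda>x. theta x z"])
  fix w assume "w \<in> Poly_Mapping.keys (qsh u v :: 'a list \<Rightarrow>\<^sub>0 'k)"
  from keys_qsh[OF this] assms
  show "theta (bvec w) z = star.tcons (weight u + weight v) (bvec w) z"
    by (auto simp: theta_bvec)
qed (intro linear_intros)+

text \<open>Expanding the left side over pairs of prefixes and the right side over pairs of nonempty
  first pieces gives double sums that the three-term rule matches. The pairs with one empty prefix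
  supply its first two terms.\<close>

lemma Gamma_star_bvec:
  fixes u v :: "'a::ab_semigroup_add list"
  shows "Gamma (star (bvec u) (bvec v) :: 'a list \<Rightarrow>\<^sub>0 'k::field) = star2 (Gamma (bvec u)) (Gamma (bvec v))"
proof (induction "length u + length v" arbitrary: u v rule: less_induct)
  case less
  show ?case
  proof (cases "u = [] \<or> v = []")
    case True
    then show ?thesis by auto
  next
    case False
    then have ne: "u \<noteq> []" "v \<noteq> []" by auto
    define x y where "x i = (bvec (take i u) :: 'a list \<Rightarrow>\<^sub>0 'k)" and "y j = (bvec (take j v) :: 'a list \<Rightarrow>\<^sub>0 'k)" for i j
    define g h where "g i = Gamma (bvec (drop i u) :: 'a list \<Rightarrow>\<^sub>0 'k)" and "h j = Gamma (bvec (drop j v) :: 'a list \<Rightarrow>\<^sub>0 'k)" for i j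
    define A B where "A i = star.tcons (weight (take i u)) (x i)" and "B j = star.tcons (weight (take j v)) (y j)" for i j
    define C where "C i j = star.tcons (weight (take i u) + weight (take j v)) (star (x i) (y j)) (star2 (g i) (h j))" for i j
    let ?I = "{0<..length u}" and ?J = "{0<..length v}"
    have g0: "g 0 = (\<Sum>i\<in>?I. A i (g i))" and h0: "h 0 = (\<Sum>j\<in>?J. B j (h j))"
      by (simp_all add: g_def h_def A_def B_def x_def y_def Gamma_rec ne)
    have lin: "linmap (A i)" "linmap (B j)" for i j
      unfolding A_def B_def by (intro linear_intros)+
    \<comment> \<open>The pair (0, 0) is out of reach of the induction hypothesis, the total length
      not having dropped, but \<open>theta\<close> vanishes there.\<close>
    have summand: "theta (star (x i) (y j)) (Gamma (star (bvec (drop i u)) (bvec (drop j v)))) =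
        (if i = 0 then if j = 0 then 0 else B j (star2 (g 0) (h j))
         else if j = 0 then A i (star2 (g i) (h 0)) else C i j)"
      if "i \<le> length u" "j \<le> length v" for i j
    proof (cases "i = 0 \<and> j = 0")
      case True
      then show ?thesis by (simp add: x_def y_def theta_bvec)
    next
      case False
      then have "Gamma (star (bvec (drop i u)) (bvec (drop j v))) = star2 (g i) (h j)"
        unfolding g_def h_def using that ne by (intro less) auto
      with False ne show ?thesis
        by (auto simp: x_def y_def A_def B_def C_def theta_bvec theta_star)
    qed
    \<comment> \<open>The uncut word is expanded once more, which turns the two boundary sums into
      double sums over nonempty prefixes.\<close>
    have expand: "B j (star2 (g 0) (h j)) = (\<Sum>i\<in>?I. B j (star2 (A i (g i)) (h j)))"
      "A i (star2 (g i) (h 0)) = (\<Sum>j\<in>?J. A i (star2 (g i) (B j (h j))))" for i j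
      by (simp_all add: g0 h0 tprod_simps linmap_app_sum lin)
    have product: "star2 (A i (g i)) (B j (h j)) =
        A i (star2 (g i) (B j (h j))) + B j (star2 (A i (g i)) (h j)) + C i j" for i j
      by (simp add: A_def B_def C_def star.tprod_tcons_tcons)
    have "Gamma (star (bvec u) (bvec v) :: 'a list \<Rightarrow>\<^sub>0 'k) =
        theta_lin (tmap (\<lambda>x. x) Gamma (star2 (Delta (bvec u)) (Delta (bvec v))))"
      by (subst Gamma_Delta) (simp add: eps_star eps_bvec ne Delta_star)
    also have "\<dots> = (\<Sum>i\<le>length u. \<Sum>j\<le>length v.
       theta (star (x i) (y j)) (Gamma (star (bvec (drop i u)) (bvec (drop j v)))))"
      by (simp add: Delta_bvec tprod_simps star.tprod_star_tensor theta_lin_tensor tmap_tensor linear_intros x_def y_def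
         linmap_app_sum[of "\<lambda>z. theta_lin (tmap (\<lambda>x. x) Gamma z)"] del: tensor_bvec) (rule sum.swap)
    also have "\<dots> = (\<Sum>j\<in>?J. B j (star2 (g 0) (h j))) + (\<Sum>i\<in>?I. A i (star2 (g i) (h 0)) + (\<Sum>j\<in>?J. C i j))"
      by (simp add: summand sum_atMost_split0)
    also have "\<dots> = (\<Sum>i\<in>?I. \<Sum>j\<in>?J. B j (star2 (A i (g i)) (h j))) + (\<Sum>i\<in>?I. \<Sum>j\<in>?J. A i (star2 (g i) (B j (h j))))
       + (\<Sum>i\<in>?I. \<Sum>j\<in>?J. C i j)"
      unfolding expand sum.distrib by (subst sum.swap) (simp only: add.assoc)
    also have "\<dots> = (\<Sum>i\<in>?I. \<Sum>j\<in>?J. star2 (A i (g i)) (B j (h j)))"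
      unfolding product sum.distrib by (simp only: ac_simps)
    also have "\<dots> = star2 (g 0) (h 0)"
      unfolding g0 h0 tprod_simps by (rule sum.swap)
    finally show ?thesis by (simp add: g_def h_def)
  qed
qed

lemma Gamma_star: "Gamma (star x y) = star2 (Gamma x) (Gamma y)"
  by (rule bilinear_eqI[where f = "\<lambda>x y. Gamma (star x y)" and g = "\<lambda>x y. star2 (Gamma x) (Gamma y)"])
     (intro linear_intros | rule Gamma_star_bvec)+

text \<open>Hence all left words in \<Gamma>(u) have the weight of u, the fact on which
  coassociativity rests.\<close>

lemma weight_map_weight: "ws \<noteq> [] \<Longrightarrow> \<forall>u\<in>set ws. u \<noteq> [] \<Longrightarrow> weight (map weight ws) = weight (concat ws)"
proof (induction ws)
  case (Cons u ws)
  then show ?case by (cases "ws = []") (auto simp: weight_Cons weight_append)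
qed simp

lemma tensor_tensor_eqI:
  assumes "linmap f" "linmap g"
    and "\<And>a b c d. f (tensor (tensor a b) (tensor c d)) = g (tensor (tensor a b) (tensor c d))"
  shows "f x = g x"
proof (rule linmap_eqI[OF assms(1,2)])
  fix b show "f (bvec b) = g (bvec b)"
    using assms(3)[of "bvec (fst (fst b))" "bvec (snd (fst b))" "bvec (fst (snd b))" "bvec (snd (snd b))"]
    by simp
qed

section \<open>The comodule identity\<close>

definition mu :: "('a::ab_semigroup_add list \<times> 'a list \<Rightarrow>\<^sub>0 'k::field) \<Rightarrow> ('a list \<Rightarrow>\<^sub>0 'k)" where
  "mu = lin (\<lambda>(b, d). star (bvec b) (bvec d))"

lemma linmap_mu [linear_intros]: "linmap g \<Longrightarrow> linmap (\<lambda>x. mu (g x))"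
  unfolding mu_def by (intro linear_intros)

lemma mu_tensor: "mu (tensor x y) = star x y"
  by (rule bilinear_eqI[where f = "\<lambda>x y. mu (tensor x y)"])
    (intro linear_intros | simp add: mu_def)+

text \<open>This is \<tau>23 followed by Id \<otimes> Id \<otimes> m. Triple tensors are nested to
  the left, so Id \<otimes> Id is one identity map on pairs.\<close>

definition merge :: "(('a list \<times> 'b list) \<times> ('c list \<times> 'b::ab_semigroup_add list) \<Rightarrow>\<^sub>0 'k::field)
    \<Rightarrow> (('a list \<times> 'c list) \<times> 'b list \<Rightarrow>\<^sub>0 'k)" where
  "merge z = tmap (\<lambda>z. z) mu (tau23 z)"

lemma linmap_merge [linear_intros]: "linmap g \<Longrightarrow> linmap (\<lambda>x. merge (g x))"
  unfolding merge_def by (intro linear_intros)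

lemma merge_tensor: "merge (tensor (tensor a b) (tensor c d)) = tensor (tensor a c) (star b d)"
  by (simp add: merge_def tau23_tensor tmap_tensor mu_tensor linear_intros)

lemma merge_one_tensor: "merge (tensor (bvec ([], [])) (tensor c d)) = tensor (tensor one_H c) d"
  using merge_tensor[of one_H one_H c d] by simp

text \<open>The action on triple tensors: p \<otimes> q \<otimes> r becomes ap \<otimes> q \<otimes>
  (u \<star> r).\<close>

definition lcons :: "'a::ab_semigroup_add \<Rightarrow> ('a list \<Rightarrow>\<^sub>0 'k::field) \<Rightarrow> (('a list \<times> 'a list) \<times> 'a list \<Rightarrow>\<^sub>0 'k)
    \<Rightarrow> (('a list \<times> 'a list) \<times> 'a list \<Rightarrow>\<^sub>0 'k)" where
  "lcons a u = tmap (star.tcons a one_H) (star u)"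

lemma linmap_lcons [linear_intros]: "linmap g \<Longrightarrow> linmap (\<lambda>x. lcons a u (g x))"
  unfolding lcons_def by (intro linear_intros)

lemma lcons_tensor: "lcons a u (tensor x y) = tensor (star.tcons a one_H x) (star u y)"
  by (simp add: lcons_def tmap_tensor linear_intros)

lemma merge_tcons: "merge (tensor (star.tcons a u x) y) = lcons a u (merge (tensor x y))"
  by (rule tensor_bilinear_eqI[where f = "\<lambda>x y. merge (tensor (star.tcons a u x) y)"
        and g = "\<lambda>x y. lcons a u (merge (tensor x y))"])
    (auto simp: bilinear_def star.tcons_tensor merge_tensor lcons_tensor star_assoc intro!: linear_intros)

text \<open>The cut in front of \<open>a\<close> is written as a \<open>merge\<close> with
  \<Gamma>(\<one>), the shape of the summand for the empty prefix in the comodule identity.\<close>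

lemma Delta_id_tcons:
  "tmap Delta (\<lambda>z. z) (star.tcons a u x)
    = merge (tensor (bvec ([], [])) (star.tcons a u x)) + lcons a u (tmap Delta (\<lambda>z. z) x)"
  by (rule tensor_eqI[where f = "\<lambda>x. tmap Delta (\<lambda>z. z) (star.tcons a u x)"])
    (auto simp: star.tcons_tensor merge_one_tensor lcons_tensor tmap_tensor linear_intros Delta_cons_lin tensor_simps
       intro!: linear_intros)

text \<open>Here \<open>i\<close> will be the cut of the word, \<open>k\<close> the end of the first
  piece to its left, and \<open>j\<close> the distance between them.\<close>

lemma sum_triangle_reindex:
  fixes f :: "nat \<Rightarrow> nat \<Rightarrow> 'b::comm_monoid_add"
  shows "(\<Sum>i\<in>{0<..n}. \<Sum>k\<in>{0<..i}. f k i) = (\<Sum>k\<in>{0<..n}. \<Sum>j\<le>n - k. f k (k + j))"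
proof -
  have "(\<Sum>i\<in>{0<..n}. \<Sum>k\<in>{0<..i}. f k i) = (\<Sum>(i, k)\<in>(SIGMA i:{0<..n}. {0<..i}). f k i)"
    by (simp add: sum.Sigma)
  also have "\<dots> = (\<Sum>(k, j)\<in>(SIGMA k:{0<..n}. {..n - k}). f k (k + j))"
    by (rule sum.reindex_bij_witness[where i = "\<lambda>(k, j). (k + j, k)" and j = "\<lambda>(i, k). (k, i - k)"]) auto
  also have "\<dots> = (\<Sum>k\<in>{0<..n}. \<Sum>j\<le>n - k. f k (k + j))"
    by (simp add: sum.Sigma)
  finally show ?thesis .
qed

lemma Delta_id_Gamma_bvec:
  fixes w :: "'a::ab_semigroup_add list"
  shows "tmap Delta (\<lambda>z. z) (Gamma (bvec w :: 'a list \<Rightarrow>\<^sub>0 'k::field)) = (\<Sum>i\<le>length w. merge (tensor (Gamma (bvec (take i w))) (Gamma (bvec (drop i w)))))"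
proof (induction "length w" arbitrary: w rule: less_induct)
  case less
  show ?case
  proof (cases "w = []")
    case True
    have "tmap Delta (\<lambda>z. z) (tensor one_H one_H :: 'a list \<times> 'a list \<Rightarrow>\<^sub>0 'k) = tensor (tensor one_H one_H) one_H"
      by (subst tmap_tensor) (auto intro!: linear_intros)
    then show ?thesis
      using True by (simp add: merge_def tau23_def tmap_def mu_def)
  next
    case False
    let ?wt = "\<lambda>i. weight (take i w)" and ?u = "\<lambda>i. bvec (take i w) :: 'a list \<Rightarrow>\<^sub>0 'k" and ?I = "{0<..length w}"
    have "tmap Delta (\<lambda>z. z) (Gamma (bvec w :: 'a list \<Rightarrow>\<^sub>0 'k)) =
       (\<Sum>k\<in>?I. merge (tensor (bvec ([], [])) (star.tcons (?wt k) (?u k) (Gamma (bvec (drop k w)))))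
         + lcons (?wt k) (?u k) (tmap Delta (\<lambda>z. z) (Gamma (bvec (drop k w)))))"
      by (simp add: Gamma_rec[OF False] linmap_app_sum linear_intros Delta_id_tcons)
    also have "\<dots> = merge (tensor (bvec ([], [])) (Gamma (bvec w)))
         + (\<Sum>k\<in>?I. lcons (?wt k) (?u k) (tmap Delta (\<lambda>z. z) (Gamma (bvec (drop k w)))))"
      by (simp add: Gamma_rec[OF False] sum.distrib tensor_simps linmap_app_sum[OF linmap_merge[OF linmap_ident]])
    also have "(\<Sum>k\<in>?I. lcons (?wt k) (?u k) (tmap Delta (\<lambda>z. z) (Gamma (bvec (drop k w))))) =
      (\<Sum>k\<in>?I. \<Sum>j\<le>length w - k. lcons (?wt k) (?u k)
         (merge (tensor (Gamma (bvec (take j (drop k w)))) (Gamma (bvec (drop j (drop k w)))))))"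
      by (intro sum.cong refl, subst less)
        (auto simp: linmap_app_sum[OF linmap_lcons[OF linmap_ident]])
    \<comment> \<open>With the cut fixed outside, the inner sum runs over first pieces of
      \<open>take i w\<close>, so the recursion for its \<Gamma> can be read backwards.\<close>
    also have "\<dots> = (\<Sum>i\<in>?I. \<Sum>k\<in>{0<..i}. lcons (?wt k) (?u k)
         (merge (tensor (Gamma (bvec (drop k (take i w)))) (Gamma (bvec (drop i w))))))"
      by (subst sum_triangle_reindex) (simp add: drop_take add.commute)
    also have "\<dots> = (\<Sum>i\<in>?I. merge (tensor (Gamma (bvec (take i w))) (Gamma (bvec (drop i w)))))"
    proof (rule sum.cong[OF refl])
      fix i assume i: "i \<in> ?I"
      then have "take i w \<noteq> []" using False by auto
      moreover have "min k i = k" if "k \<in> {0<..i}" for k using that by auto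
      ultimately show "(\<Sum>k\<in>{0<..i}. lcons (?wt k) (?u k)
         (merge (tensor (Gamma (bvec (drop k (take i w)))) (Gamma (bvec (drop i w))))))
         = merge (tensor (Gamma (bvec (take i w))) (Gamma (bvec (drop i w))))"
        using i by (simp add: Gamma_rec[of "take i w"] tensor_simps linmap_app_sum[OF linmap_merge[OF linmap_ident]]
            merge_tcons min.absorb2)
    qed
    finally show ?thesis
      by (simp add: sum_atMost_split0)
  qed
qed

lemma Delta_id_Gamma: "tmap Delta (\<lambda>z. z) (Gamma x) = merge (tmap Gamma Gamma (Delta x))"
proof (rule linmap_eqI[where f = "\<lambda>x. tmap Delta (\<lambda>z. z) (Gamma x)"])
  fix w
  show "tmap Delta (\<lambda>z. z) (Gamma (bvec w)) = merge (tmap Gamma Gamma (Delta (bvec w)))"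
    by (subst Delta_apply[of "\<lambda>x. merge (tmap Gamma Gamma x)"])
      (auto intro!: linear_intros simp: Delta_id_Gamma_bvec tmap_tensor linear_intros simp del: tensor_bvec)
qed (intro linear_intros)+

subsection \<open>The counit axioms\<close>

lemma eps_id_tcons: "tmapf_left eps (star.tcons a u x) = 0"
  by (rule tensor_eqI[where f = "\<lambda>x. tmapf_left eps (star.tcons a u x)"])
    (auto simp: star.tcons_tensor tmapf_left_tensor linear_intros eps_cons_lin intro!: linear_intros)

lemma eps_id_Gamma: "tmapf_left eps (Gamma x) = unitH (eps x)"
  unfolding unitH_def
proof (rule linmap_eqI[where f = "\<lambda>x. tmapf_left eps (Gamma x)"])
  fix w
  show "tmapf_left eps (Gamma (bvec w)) = smult_pm (eps (bvec w)) one_H"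
    by (cases "w = []")
      (simp add: tmapf_left_def eps_bvec, simp add: Gamma_rec linmap_app_sum linear_intros eps_id_tcons eps_bvec)
qed (intro linear_intros)+

lemma eps_Gamma_id_tcons: "tmapf_left eps_Gamma (star.tcons a u x) = star u (tmapf_left eps x)"
  by (rule tensor_eqI[where f = "\<lambda>x. tmapf_left eps_Gamma (star.tcons a u x)"])
    (auto simp: star.tcons_tensor tmapf_left_tensor linear_intros eps_Gamma_cons_lin star_simps intro!: linear_intros)

text \<open>Only the decomposition with a single piece has a one-letter left word, and its right
  word is \<open>w\<close>.\<close>

lemma eps_Gamma_id_Gamma: "tmapf_left eps_Gamma (Gamma x) = x"
proof (rule linmap_eqI[where f = "\<lambda>x. tmapf_left eps_Gamma (Gamma x)"])
  fix w :: "'a list"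
  show "tmapf_left eps_Gamma (Gamma (bvec w :: 'a list \<Rightarrow>\<^sub>0 'b)) = bvec w"
  proof (cases "w = []")
    case True
    then show ?thesis by (simp add: tmapf_left_def eps_Gamma_bvec)
  next
    case False
    have "tmapf_left eps_Gamma (Gamma (bvec w :: 'a list \<Rightarrow>\<^sub>0 'b)) =
      (\<Sum>i\<in>{0<..length w}. if i = length w then bvec w else 0)"
      unfolding Gamma_rec[OF False] linmap_app_sum[OF linmap_tmapf_left[OF linmap_ident]]
      by (rule sum.cong[OF refl]) (auto simp: eps_Gamma_id_tcons eps_id_Gamma unitH_def eps_bvec star_simps)
    with False show ?thesis by simp
  qed
qed (intro linear_intros)+

lemma id_eps_Gamma_tcons:
  "tmapf_right eps_Gamma (star.tcons a u x) = smult_pm (eps_Gamma u) (cons_lin a (tmapf_right eps_Gamma x))"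
  by (rule tensor_eqI[where f = "\<lambda>x. tmapf_right eps_Gamma (star.tcons a u x)"])
    (auto simp: star.tcons_tensor tmapf_right_tensor linear_intros eps_Gamma_star cons_lin_simps intro!: linear_intros)

text \<open>By multiplicativity \<open>eps_Gamma\<close> kills a product of pieces unless all of
  them are letters, so only the decomposition into letters survives.\<close>

lemma id_eps_Gamma_Gamma: "tmapf_right eps_Gamma (Gamma x) = x"
proof (rule linmap_eqI[where f = "\<lambda>x. tmapf_right eps_Gamma (Gamma x)"])
  fix w :: "'a list"
  show "tmapf_right eps_Gamma (Gamma (bvec w :: 'a list \<Rightarrow>\<^sub>0 'b)) = bvec w"
  proof (induction w)
    case Nil
    then show ?case by (simp add: tmapf_right_def eps_Gamma_bvec)
  next
    case (Cons a w)
    have "tmapf_right eps_Gamma (Gamma (bvec (a # w) :: 'a list \<Rightarrow>\<^sub>0 'b)) =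
      (\<Sum>i\<in>{0<..length (a # w)}. if i = 1 then bvec (a # w) else 0)"
      unfolding Gamma_rec[OF list.distinct(2)] linmap_app_sum[OF linmap_tmapf_right[OF linmap_ident]]
    proof (rule sum.cong[OF refl])
      fix i assume "i \<in> {0<..length (a # w)}"
      then obtain j where "i = Suc j" "j \<le> length w" by (cases i) auto
      then show "tmapf_right eps_Gamma (star.tcons (weight (take i (a # w))) (bvec (take i (a # w)))
         (Gamma (bvec (drop i (a # w))))) = (if i = 1 then bvec (a # w) else (0 :: 'a list \<Rightarrow>\<^sub>0 'b))"
        by (cases "j = 0") (auto simp: id_eps_Gamma_tcons eps_Gamma_bvec Cons.IH)
    qed
    then show ?case by simp
  qed
qed (intro linear_intros)+

subsection \<open>Coassociativity\<close>

lemma theta_lin_zero: "theta_lin (tensor one_H z) = 0"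
  by (simp add: theta_lin_tensor theta_bvec)

text \<open>Writing \<Gamma> \<otimes> Id through \<Delta> \<otimes> Id is what lets the comodule
  identity act on (\<Gamma> \<otimes> Id) \<Gamma>.\<close>

lemma Gamma_id:
  "tmap Gamma (\<lambda>z. z) x = tensor (bvec ([], [])) (tmapf_left eps x)
     + tmap (\<lambda>z. theta_lin (tmap (\<lambda>z. z) Gamma z)) (\<lambda>z. z) (tmap Delta (\<lambda>z. z) x)"
proof (rule tensor_eqI[where f = "\<lambda>x. tmap Gamma (\<lambda>z. z) x"])
  fix x y
  have "tmap Gamma (\<lambda>z. z) (tensor x y) = tensor (smult_pm (eps x) (bvec ([], [])) + theta_lin (tmap (\<lambda>x. x) Gamma (Delta x))) y"
    unfolding Gamma_Delta[of x, symmetric] by (simp add: tmap_tensor linear_intros)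
  also have "\<dots> = tensor (bvec ([], [])) (tmapf_left eps (tensor x y))
     + tmap (\<lambda>z. theta_lin (tmap (\<lambda>z. z) Gamma z)) (\<lambda>z. z) (tmap Delta (\<lambda>z. z) (tensor x y))"
    by (simp add: tmap_tensor tmapf_left_tensor linear_intros tensor_simps)
  finally show "tmap Gamma (\<lambda>z. z) (tensor x y) = \<dots>" .
qed (intro linear_intros)+

lemma tassoc_tcons:
  "tassoc (tensor (star.tcons a p z) (star q y)) = star2.tcons a (tensor p q) (tassoc (tensor z y))"
  by (rule tensor_eqI[where f = "\<lambda>z. tassoc (tensor (star.tcons a p z) (star q y))"])
    (auto simp: star.tcons_tensor star2.tcons_tensor tassoc_tensor star.tprod_star_tensor intro!: linear_intros)

text \<open>Applied to \<open>(\<Delta> \<otimes> Id) \<Gamma>(w)\<close> for w nonempty, this yields \<open>(\<Gamma> \<otimes> Id) \<Gamma>(w)\<close> reassociated.\<close>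

definition regroup :: "(('a::ab_semigroup_add list \<times> 'a list) \<times> 'b list \<Rightarrow>\<^sub>0 'k::field) \<Rightarrow> ('a list \<times> ('a list \<times> 'b list) \<Rightarrow>\<^sub>0 'k)" where
  "regroup z = tassoc (tmap (\<lambda>z. theta_lin (tmap (\<lambda>z. z) Gamma z)) (\<lambda>z. z) z)"

lemma linmap_regroup [linear_intros]: "linmap g \<Longrightarrow> linmap (\<lambda>x. regroup (g x))"
  unfolding regroup_def by (intro linear_intros)

lemma regroup_tensor: "regroup (tensor (tensor x y) z) = tassoc (tensor (theta_lin (tensor x (Gamma y))) z)"
  by (simp add: regroup_def tmap_tensor linear_intros)

lemma regroup_merge_word:
  assumes "p \<noteq> []"
  shows "regroup (merge (tensor (tensor (bvec p) q) y)) = star2.tcons (weight p) (tensor (bvec p) q) (tassoc (tmap Gamma (\<lambda>z. z) y))"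
  by (rule tensor_eqI[where f = "\<lambda>y. regroup (merge (tensor (tensor (bvec p) q) y))"])
   (auto simp: merge_tensor regroup_tensor theta_lin_tensor theta_bvec assms tassoc_tcons tmap_tensor linear_intros intro!: linear_intros)

lemma regroup_merge_one: "regroup (merge (tensor (bvec ([], [])) y)) = 0"
  by (rule tensor_eqI[where f = "\<lambda>y. regroup (merge (tensor (bvec ([], [])) y))"])
   (auto simp: merge_one_tensor regroup_tensor theta_lin_zero tensor_simps linmap_app_zero[OF linmap_tassoc[OF linmap_ident]] intro!: linear_intros)

text \<open>All left words of \<Gamma>(u) act with the same letter, the weight of u, so the sum over
  decompositions collapses to one action whose algebra element is \<Gamma>(u).\<close>

lemma regroup_merge_Gamma:
  assumes "u \<noteq> []"
  shows "regroup (merge (tensor (Gamma (bvec u)) y)) = star2.tcons (weight u) (Gamma (bvec u)) (tassoc (tmap Gamma (\<lambda>z. z) y))"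
proof -
  have "map weight ws \<noteq> [] \<and> weight (map weight ws) = weight u" if "ws \<in> compositions u" for ws
    using that assms weight_map_weight[of ws] by (auto simp: compositions_def)
  then show ?thesis
    unfolding Gamma_bvec
    by (simp add: tensor_simps linmap_app_sum[OF linmap_merge[OF linmap_ident]] linmap_app_sum[OF linmap_regroup[OF linmap_ident]]
        linmap_app_sum[OF star2.linmap_tcons_left[OF linmap_ident]] regroup_merge_word)
qed

text \<open>Multiplicativity of \<Gamma> enters coassociativity here: it sends multiplication by
  \<open>u\<close> to multiplication by \<Gamma>(u).\<close>

lemma id_Gamma_tcons:
  "tmap (\<lambda>z. z) Gamma (star.tcons a u x) = star2.tcons a (Gamma u) (tmap (\<lambda>z. z) Gamma x)"
  by (rule tensor_eqI[where f = "\<lambda>x. tmap (\<lambda>z. z) Gamma (star.tcons a u x)"])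
    (auto simp: star.tcons_tensor star2.tcons_tensor tmap_tensor linear_intros Gamma_star intro!: linear_intros)

lemma Gamma_coassoc_bvec:
  fixes w :: "'a::ab_semigroup_add list"
  shows "tassoc (tmap Gamma (\<lambda>z. z) (Gamma (bvec w :: 'a list \<Rightarrow>\<^sub>0 'k::field))) = tmap (\<lambda>z. z) Gamma (Gamma (bvec w))"
proof (induction "length w" arbitrary: w rule: less_induct)
  case less
  show ?case
  proof (cases "w = []")
    case True
    have "tassoc (tmap Gamma (\<lambda>z. z) (tensor one_H one_H :: 'a list \<times> 'a list \<Rightarrow>\<^sub>0 'k)) = tmap (\<lambda>z. z) Gamma (tensor one_H one_H)"
      by (subst (1 2) tmap_tensor) (auto intro!: linear_intros simp: tassoc_def)
    with True show ?thesis by simp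
  next
    case False
    have "tassoc (tmap Gamma (\<lambda>z. z) (Gamma (bvec w :: 'a list \<Rightarrow>\<^sub>0 'k))) = regroup (tmap Delta (\<lambda>z. z) (Gamma (bvec w)))"
      by (subst Gamma_id) (simp add: regroup_def eps_id_Gamma eps_bvec False unitH_def tensor_simps)
    \<comment> \<open>The comodule identity; the empty prefix contributes 0 by
      \<open>regroup_merge_one\<close>, so every remaining suffix is shorter than
      \<open>w\<close>.\<close>
    also have "\<dots> = (\<Sum>i\<in>{0<..length w}. regroup (merge (tensor (Gamma (bvec (take i w))) (Gamma (bvec (drop i w))))))"
      by (simp add: Delta_id_Gamma_bvec linmap_app_sum linear_intros sum_atMost_split0 regroup_merge_one
          linmap_app_add[OF linmap_regroup[OF linmap_ident]])
    also have "\<dots> = (\<Sum>i\<in>{0<..length w}. star2.tcons (weight (take i w)) (Gamma (bvec (take i w)))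
        (tmap (\<lambda>z. z) Gamma (Gamma (bvec (drop i w)))))"
      using False by (intro sum.cong refl, subst regroup_merge_Gamma) (auto simp: less)
    also have "\<dots> = tmap (\<lambda>z. z) Gamma (Gamma (bvec w))"
      by (simp add: Gamma_rec[OF False] linmap_app_sum linear_intros id_Gamma_tcons)
    finally show ?thesis .
  qed
qed

lemma Gamma_coassoc: "tassoc (tmap Gamma (\<lambda>z. z) (Gamma x)) = tmap (\<lambda>z. z) Gamma (Gamma x)"
  by (rule linmap_eqI[where f = "\<lambda>x. tassoc (tmap Gamma (\<lambda>z. z) (Gamma x))"])
    (intro linear_intros | rule Gamma_coassoc_bvec)+

subsection \<open>The antipode\<close>

lemma linmap_S [linear_intros]: "linmap g \<Longrightarrow> linmap (\<lambda>x. S (g x))"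
  unfolding S_def by (intro linear_intros)

lemma S_one [simp]: "S one_H = one_H"
  by (simp add: S_def)

lemma sum_atMost_split_last: "(\<Sum>i\<le>n. f i) = (\<Sum>i<n. f i) + f n" for f :: "nat \<Rightarrow> 'b::comm_monoid_add"
  by (simp add: lessThan_Suc_atMost[symmetric])

lemma S_convolution_bvec:
  fixes w :: "'a::ab_semigroup_add list"
  shows "(\<Sum>i\<le>length w. star (S (bvec (take i w))) (bvec (drop i w) :: 'a list \<Rightarrow>\<^sub>0 'k::field))
     = smult_pm (eps (bvec w)) one_H"
proof (cases "w = []")
  case False
  then have "S (bvec w :: 'a list \<Rightarrow>\<^sub>0 'k) = - (\<Sum>i<length w. star (S (bvec (take i w))) (bvec (drop i w)))"
    by (simp add: S_def S_w.simps[of w] atLeast0LessThan del: S_w.simps)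
  with False show ?thesis
    by (simp add: sum_atMost_split_last eps_bvec)
qed (simp add: eps_bvec)

lemma S_convolution: "mu (tmap S (\<lambda>z. z) (Delta x)) = smult_pm (eps x) one_H"
proof (rule linmap_eqI[where f = "\<lambda>x. mu (tmap S (\<lambda>z. z) (Delta x))"])
  fix w
  show "mu (tmap S (\<lambda>z. z) (Delta (bvec w))) = smult_pm (eps (bvec w)) one_H"
    by (subst Delta_apply[of "\<lambda>x. mu (tmap S (\<lambda>z. z) x)"])
      (auto intro!: linear_intros simp: S_convolution_bvec tmap_tensor mu_tensor linear_intros simp del: tensor_bvec)
qed (intro linear_intros)+

lemma S_star_bvec:
  fixes u v :: "'a::ab_semigroup_add list"
  shows "S (star (bvec u) (bvec v) :: 'a list \<Rightarrow>\<^sub>0 'k::field) = star (S (bvec u)) (S (bvec v))"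
proof (induction "length u + length v" arbitrary: u v rule: less_induct)
  case less
  define x y x' y' :: "nat \<Rightarrow> 'a list \<Rightarrow>\<^sub>0 'k" where "x i = bvec (take i u)" and "y j = bvec (take j v)"
    and "x' i = bvec (drop i u)" and "y' j = bvec (drop j v)" for i j
  let ?D = "{..length u} \<times> {..length v}"
  define F G where "F = (\<lambda>(i, j). star (S (star (x i) (y j))) (star (x' i) (y' j)))"
    and "G = (\<lambda>(i, j). star (star (S (x i)) (S (y j))) (star (x' i) (y' j)))"
  have "smult_pm (eps (star (bvec u) (bvec v))) one_H = mu (tmap S (\<lambda>z. z) (star2 (Delta (bvec u)) (Delta (bvec v))))"
    unfolding S_convolution[symmetric] Delta_star ..
  also have "\<dots> = (\<Sum>j\<le>length v. \<Sum>i\<le>length u. F (i, j))"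
    by (simp add: Delta_bvec tprod_simps star.tprod_star_tensor F_def tmap_tensor mu_tensor linear_intros
         x_def y_def x'_def y'_def linmap_app_sum[of "\<lambda>z. mu (tmap S (\<lambda>x. x) z)"] del: tensor_bvec)
  also have "\<dots> = sum F ?D"
    by (subst sum.swap) (simp add: sum.cartesian_product)
  finally have sum_F: "sum F ?D = smult_pm (eps (star (bvec u) (bvec v))) one_H" ..
  \<comment> \<open>Commutativity separates the parts of \<open>u\<close> from those of
    \<open>v\<close>; the double sum factors into two convolutions of \<open>S\<close> with the
    identity.\<close>
  have "sum G ?D = (\<Sum>i\<le>length u. \<Sum>j\<le>length v. star (star (S (x i)) (x' i)) (star (S (y j)) (y' j)))"
    unfolding G_def by (simp add: sum.cartesian_product star_assoc star.left_comm case_prod_unfold)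
  also have "\<dots> = star (\<Sum>i\<le>length u. star (S (x i)) (x' i)) (\<Sum>j\<le>length v. star (S (y j)) (y' j))"
    unfolding star_simps by (rule sum.swap)
  also have "\<dots> = sum F ?D"
    unfolding sum_F x_def x'_def y_def y'_def S_convolution_bvec by (simp add: star_simps eps_star)
  finally have "sum G ?D = sum F ?D" .
  moreover have "F z = G z" if "z \<in> ?D - {(length u, length v)}" for z
  proof -
    obtain i j where z: "z = (i, j)" by fastforce
    have "S (star (x i) (y j)) = star (S (x i)) (S (y j))"
      unfolding x_def y_def using that by (intro less) (auto simp: z)
    then show ?thesis by (simp add: F_def G_def z)
  qed
  \<comment> \<open>Only the pair of uncut words is left, and there the second factor is the product
    of two empty words, the unit.\<close>
  ultimately have "F (length u, length v) = G (length u, length v)"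
    by (simp add: sum.remove[of ?D "(length u, length v)"])
  then show ?case by (simp add: F_def G_def x_def y_def x'_def y'_def)
qed

lemma S_star: "S (star x y) = star (S x) (S y)"
  by (rule bilinear_eqI[where f = "\<lambda>x y. S (star x y)" and g = "\<lambda>x y. star (S x) (S y)"])
     (intro linear_intros | rule S_star_bvec)+

text \<open>It brings a product with S \<otimes> Id into the form \<open>merge\<close>, to which the
  comodule identity applies.\<close>

lemma star2_S_id:
  "star2 (tmap S (\<lambda>z. z) x) y = tmap (\<lambda>z. mu (tmap S (\<lambda>z. z) z)) (\<lambda>z. z) (merge (tensor x y))"
  by (rule tensor_bilinear_eqI[where f = "\<lambda>x y. star2 (tmap S (\<lambda>z. z) x) y"
        and g = "\<lambda>x y. tmap (\<lambda>z. mu (tmap S (\<lambda>z. z) z)) (\<lambda>z. z) (merge (tensor x y))"])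
    (auto simp: bilinear_def merge_tensor tmap_tensor mu_tensor linear_intros star.tprod_star_tensor
       intro!: linear_intros)

text \<open>Both sides are left inverses of \<Gamma> for the convolution of maps from H to H
  \<otimes> H: the left one because \<Gamma> is multiplicative, the right one by the comodule
  identity.\<close>

lemma Gamma_S_bvec:
  fixes w :: "'a::ab_semigroup_add list"
  shows "Gamma (S (bvec w :: 'a list \<Rightarrow>\<^sub>0 'k::field)) = tmap S (\<lambda>z. z) (Gamma (bvec w))"
proof (induction "length w" arbitrary: w rule: less_induct)
  case less
  define x y :: "nat \<Rightarrow> 'a list \<Rightarrow>\<^sub>0 'k" where "x i = bvec (take i w)" and "y i = bvec (drop i w)" for i
  let ?n = "length w"
  have "(\<Sum>i\<le>?n. star2 (Gamma (S (x i))) (Gamma (y i))) = Gamma (\<Sum>i\<le>?n. star (S (x i)) (y i))"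
    by (simp add: Gamma_simps Gamma_star)
  also have "\<dots> = smult_pm (eps (bvec w)) (bvec ([], []))"
    by (simp add: x_def y_def S_convolution_bvec Gamma_simps)
  also have "\<dots> = tensor one_H (tmapf_left eps (Gamma (bvec w)))"
    by (simp add: eps_id_Gamma unitH_def tensor_simps)
  also have "\<dots> = tmap (\<lambda>z. smult_pm (eps z) one_H) (\<lambda>z. z) (Gamma (bvec w))"
    by (subst tmap_unit_form) (auto intro!: linear_intros)
  \<comment> \<open>The antipode relation is read backwards on the first factor, so that \<Delta>
    \<otimes> Id appears in front of \<Gamma>.\<close>
  also have "\<dots> = tmap (\<lambda>z. mu (tmap S (\<lambda>z. z) z)) (\<lambda>z. z) (tmap Delta (\<lambda>z. z) (Gamma (bvec w)))"
    by (simp add: S_convolution tmap_tmap linear_intros)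
  also have "\<dots> = (\<Sum>i\<le>?n. star2 (tmap S (\<lambda>z. z) (Gamma (x i))) (Gamma (y i)))"
    by (simp add: Delta_id_Gamma_bvec linmap_app_sum linear_intros star2_S_id x_def y_def)
  finally have sums: "(\<Sum>i\<le>?n. star2 (Gamma (S (x i))) (Gamma (y i))) =
    (\<Sum>i\<le>?n. star2 (tmap S (\<lambda>z. z) (Gamma (x i))) (Gamma (y i)))" .
  have "Gamma (S (x i)) = tmap S (\<lambda>z. z) (Gamma (x i))" if "i < ?n" for i
    unfolding x_def using that by (intro less) auto
  with sums have "star2 (Gamma (S (x ?n))) (Gamma (y ?n)) = star2 (tmap S (\<lambda>z. z) (Gamma (x ?n))) (Gamma (y ?n))"
    by (simp add: sum_atMost_split_last)
  then show ?case by (simp add: x_def y_def)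
qed

lemma Gamma_S: "Gamma (S x) = tmap S (\<lambda>z. z) (Gamma x)"
  by (rule linmap_eqI[where f = "\<lambda>x. Gamma (S x)"])
    (intro linear_intros | rule Gamma_S_bvec)+

subsection \<open>Morphism properties\<close>

lemma alg_hom_tau23:
  assumes "bilinear p1" "bilinear p2" "bilinear p3" "bilinear p4"
  shows "alg_hom (tprod (tprod p1 p2) (tprod p3 p4)) (tensor (tensor e1 e2) (tensor e3 e4))
    (tprod (tprod p1 p3) (tprod p2 p4)) (tensor (tensor e1 e3) (tensor e2 e4)) tau23"
  unfolding alg_hom_def
proof (intro conjI allI)
  note tprod = tprod_tensor[OF assms(1,2)] tprod_tensor[OF assms(3,4)] tprod_tensor[OF assms(1,3)]
    tprod_tensor[OF assms(2,4)] tprod_tensor[OF bilinear_tprod bilinear_tprod]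
  fix x y
  show "tau23 (tprod (tprod p1 p2) (tprod p3 p4) x y) = tprod (tprod p1 p3) (tprod p2 p4) (tau23 x) (tau23 y)"
  proof (rule tensor_tensor_eqI[where f = "\<lambda>x. tau23 (tprod (tprod p1 p2) (tprod p3 p4) x y)"])
    fix a b c d
    show "tau23 (tprod (tprod p1 p2) (tprod p3 p4) (tensor (tensor a b) (tensor c d)) y)
      = tprod (tprod p1 p3) (tprod p2 p4) (tau23 (tensor (tensor a b) (tensor c d))) (tau23 y)"
      by (rule tensor_tensor_eqI[where f = "\<lambda>y. tau23 (tprod (tprod p1 p2) (tprod p3 p4) (tensor (tensor a b) (tensor c d)) y)"])
        (intro linear_intros | simp add: tau23_tensor tprod)+
  qed (intro linear_intros)+
qed (simp add: tau23_tensor)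

text \<open>Commutativity of \<star> is what makes the product map a morphism.\<close>

lemma alg_hom_mu: "alg_hom star2 (tensor one_H one_H) star one_H mu"
  unfolding alg_hom_def
proof (intro conjI allI)
  fix x y
  show "mu (star2 x y) = star (mu x) (mu y)"
    by (rule tensor_bilinear_eqI[where f = "\<lambda>x y. mu (star2 x y)" and g = "\<lambda>x y. star (mu x) (mu y)"])
      (auto simp: bilinear_def mu_tensor star.tprod_star_tensor star_assoc star.left_comm intro!: linear_intros)
qed (simp only: mu_tensor star_one_left)

lemma alg_hom_eps_id: "alg_hom star2 (tensor one_H one_H) star one_H (tmapf_left eps)"
  unfolding alg_hom_def
proof (intro conjI allI)
  fix x y
  show "tmapf_left eps (star2 x y) = star (tmapf_left eps x) (tmapf_left eps y)"
    by (rule tensor_bilinear_eqI[where f = "\<lambda>x y. tmapf_left eps (star2 x y)"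
          and g = "\<lambda>x y. star (tmapf_left eps x) (tmapf_left eps y)"])
      (auto simp: bilinear_def tmapf_left_tensor linear_intros star.tprod_star_tensor eps_star star_simps
        intro!: linear_intros)
qed (simp add: tmapf_left_def eps_bvec)

section \<open>Failure of cocommutativity\<close>

lemma tcons_bvec: "star.tcons a r (bvec (u, v)) = tensor (bvec (a # u)) (star r (bvec v))"
  using star.tcons_tensor[of a r "bvec u" "bvec v"] by simp

lemma Gamma_letter: "Gamma (bvec [a]) = bvec ([a], [a])"
proof -
  have "{0<..Suc 0} = {Suc 0}" by auto
  then show ?thesis by (simp add: Gamma_rec tcons_bvec)
qed

lemma Gamma_two_letters:
  "Gamma (bvec [a, b]) = bvec ([a, b], [a, b]) + bvec ([a, b], [b, a]) + bvec ([a, b], [a + b]) + bvec ([a + b], [a, b])"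
proof -
  have "{0<..Suc (Suc 0)} = {Suc 0, Suc (Suc 0)}" by auto
  then show ?thesis
    by (simp add: Gamma_rec[of "[a, b]"] Gamma_letter tcons_bvec star_bvec tensor_simps)
qed

text \<open>The word 10 occurs as a right factor in \<Gamma>(01) but never as a left one. The
  coefficient of 01 \<otimes> 10 is 1 against 0 after the flip, which differ over every
  field.\<close>

lemma not_cocommutative: "tflip (Gamma (bvec [0, 1] :: nat list \<Rightarrow>\<^sub>0 'k::field)) \<noteq> Gamma (bvec [0, 1])"
proof
  let ?x = "bvec [0, 1] :: nat list \<Rightarrow>\<^sub>0 'k"
  assume eq: "tflip (Gamma ?x) = Gamma ?x"
  have lin: "linmap tflip"
    unfolding tflip_def by (intro linear_intros)
  have "tflip (Gamma ?x) = bvec ([0, 1], [0, 1]) + bvec ([1, 0], [0, 1]) + bvec ([1], [0, 1]) + bvec ([0, 1], [1])"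
    unfolding Gamma_two_letters linmap_app_add[OF lin] by (simp add: tflip_def)
  then have "Poly_Mapping.lookup (Gamma ?x) ([0, 1], [1, 0]) = 0"
    unfolding eq by (simp add: lookup_add lookup_single)
  then show False
    unfolding Gamma_two_letters by (simp add: lookup_add lookup_single)
qed

theorem theorem3p1:
  fixes dummy :: "'a::ab_semigroup_add \<times> 'k::field"
  shows
  \<comment> \<open>(i) coassociativity\<close>
  "(\<forall>x :: 'a list \<Rightarrow>\<^sub>0 'k.
      tassoc (tmap Gamma (\<lambda>z. z) (Gamma x)) = tmap (\<lambda>z. z) Gamma (Gamma x))
   \<comment> \<open>(i) not cocommutative in general (witness: Omega = nat)\<close>
   \<and> (\<exists>x :: nat list \<Rightarrow>\<^sub>0 'k. tflip (Gamma x) \<noteq> Gamma x)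
   \<comment> \<open>(ii) compatibility with the quasi-shuffle product\<close>
   \<and> (\<forall>x y :: 'a list \<Rightarrow>\<^sub>0 'k. Gamma (star x y) = star2 (Gamma x) (Gamma y))
   \<comment> \<open>(ii) bialgebra axioms for (H, \<star>, Gamma, eps_Gamma)\<close>
   \<and> (\<forall>x y z :: 'a list \<Rightarrow>\<^sub>0 'k. star (star x y) z = star x (star y z))
   \<and> (\<forall>x :: 'a list \<Rightarrow>\<^sub>0 'k. star one_H x = x \<and> star x one_H = x)
   \<and> alg_hom star one_H star2 (tensor one_H one_H) (Gamma :: ('a list \<Rightarrow>\<^sub>0 'k) \<Rightarrow> _)
   \<and> alg_hom star one_H (*) 1 (eps_Gamma :: ('a list \<Rightarrow>\<^sub>0 'k) \<Rightarrow> 'k)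
   \<and> (\<forall>x :: 'a list \<Rightarrow>\<^sub>0 'k. tmapf_left eps_Gamma (Gamma x) = x
                            \<and> tmapf_right eps_Gamma (Gamma x) = x)
   \<comment> \<open>(iii) right comodule-Hopf algebra\<close>
   \<and> (\<forall>x :: 'a list \<Rightarrow>\<^sub>0 'k.
        tmap Delta (\<lambda>z. z) (Gamma x)
        = tmap (\<lambda>z. z) (lin (\<lambda>(b, d). star (bvec b) (bvec d)))
            (tau23 (tmap Gamma Gamma (Delta x))))
   \<and> (\<forall>x :: 'a list \<Rightarrow>\<^sub>0 'k. tmapf_left eps (Gamma x) = unitH (eps x))
   \<and> (\<forall>x :: 'a list \<Rightarrow>\<^sub>0 'k. Gamma (S x) = tmap S (\<lambda>z. z) (Gamma x))
   \<comment> \<open>(iii) all the maps involved are algebra morphisms\<close>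
   \<and> alg_hom star one_H star2 (tensor one_H one_H) (Delta :: ('a list \<Rightarrow>\<^sub>0 'k) \<Rightarrow> _)
   \<and> alg_hom star2 (tensor one_H one_H) (tprod star2 star) (tensor (tensor one_H one_H) one_H)
       (tmap Delta (\<lambda>z. z) :: (('a list \<times> 'a list) \<Rightarrow>\<^sub>0 'k) \<Rightarrow> _)
   \<and> alg_hom star2 (tensor one_H one_H) (tprod star2 star2)
       (tensor (tensor one_H one_H) (tensor one_H one_H))
       (tmap Gamma Gamma :: (('a list \<times> 'a list) \<Rightarrow>\<^sub>0 'k) \<Rightarrow> _)
   \<and> alg_hom (tprod star2 star2) (tensor (tensor one_H one_H) (tensor one_H one_H))
       (tprod star2 star2) (tensor (tensor one_H one_H) (tensor one_H one_H))
       (tau23 :: ((('a list \<times> 'a list) \<times> ('a list \<times> 'a list)) \<Rightarrow>\<^sub>0 'k) \<Rightarrow> _)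
   \<and> alg_hom (tprod star2 star2) (tensor (tensor one_H one_H) (tensor one_H one_H))
       (tprod star2 star) (tensor (tensor one_H one_H) one_H)
       (tmap (\<lambda>z. z) (lin (\<lambda>(b, d). star (bvec b) (bvec d)))
         :: ((('a list \<times> 'a list) \<times> ('a list \<times> 'a list)) \<Rightarrow>\<^sub>0 'k) \<Rightarrow> _)
   \<and> alg_hom star2 (tensor one_H one_H) star one_H
       (tmapf_left eps :: (('a list \<times> 'a list) \<Rightarrow>\<^sub>0 'k) \<Rightarrow> _)
   \<and> alg_hom star one_H (*) 1 (eps :: ('a list \<Rightarrow>\<^sub>0 'k) \<Rightarrow> 'k)
   \<and> alg_hom (*) 1 star one_H (unitH :: 'k \<Rightarrow> ('a list \<Rightarrow>\<^sub>0 'k))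
   \<and> alg_hom star one_H star one_H (S :: ('a list \<Rightarrow>\<^sub>0 'k) \<Rightarrow> _)
   \<and> alg_hom star2 (tensor one_H one_H) star2 (tensor one_H one_H)
       (tmap S (\<lambda>z. z) :: (('a list \<times> 'a list) \<Rightarrow>\<^sub>0 'k) \<Rightarrow> _)"
proof (intro conjI)
  have Gamma_hom: "alg_hom star one_H star2 (tensor one_H one_H) (Gamma :: ('a list \<Rightarrow>\<^sub>0 'k) \<Rightarrow> _)"
    by (simp add: alg_hom_def Gamma_star)
  have Delta_hom: "alg_hom star one_H star2 (tensor one_H one_H) (Delta :: ('a list \<Rightarrow>\<^sub>0 'k) \<Rightarrow> _)"
    by (simp add: alg_hom_def Delta_star)
  have S_hom: "alg_hom star one_H star one_H (S :: ('a list \<Rightarrow>\<^sub>0 'k) \<Rightarrow> _)"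
    by (simp add: alg_hom_def S_star)
  note bilinear = bilinear_star bilinear_tprod
    and linear = linmap_ident linmap_Gamma[OF linmap_ident] linmap_Delta[OF linmap_ident]
      linmap_S[OF linmap_ident] linmap_mu[OF linmap_ident]
  show "\<forall>x :: 'a list \<Rightarrow>\<^sub>0 'k. tassoc (tmap Gamma (\<lambda>z. z) (Gamma x)) = tmap (\<lambda>z. z) Gamma (Gamma x)"
    by (simp add: Gamma_coassoc)
  show "\<exists>x :: nat list \<Rightarrow>\<^sub>0 'k. tflip (Gamma x) \<noteq> Gamma x"
    using not_cocommutative by blast
  show "\<forall>x y :: 'a list \<Rightarrow>\<^sub>0 'k. Gamma (star x y) = star2 (Gamma x) (Gamma y)"
    by (simp add: Gamma_star)
  show "\<forall>x y z :: 'a list \<Rightarrow>\<^sub>0 'k. star (star x y) z = star x (star y z)"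
    by (simp add: star_assoc)
  show "\<forall>x :: 'a list \<Rightarrow>\<^sub>0 'k. star one_H x = x \<and> star x one_H = x"
    by simp
  show "alg_hom star one_H star2 (tensor one_H one_H) (Gamma :: ('a list \<Rightarrow>\<^sub>0 'k) \<Rightarrow> _)"
    by (fact Gamma_hom)
  show "alg_hom star one_H (*) 1 (eps_Gamma :: ('a list \<Rightarrow>\<^sub>0 'k) \<Rightarrow> 'k)"
    by (simp add: alg_hom_def eps_Gamma_star eps_Gamma_bvec)
  show "\<forall>x :: 'a list \<Rightarrow>\<^sub>0 'k. tmapf_left eps_Gamma (Gamma x) = x \<and> tmapf_right eps_Gamma (Gamma x) = x"
    by (simp add: eps_Gamma_id_Gamma id_eps_Gamma_Gamma)
  show "\<forall>x :: 'a list \<Rightarrow>\<^sub>0 'k. tmap Delta (\<lambda>z. z) (Gamma x)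
        = tmap (\<lambda>z. z) (lin (\<lambda>(b, d). star (bvec b) (bvec d))) (tau23 (tmap Gamma Gamma (Delta x)))"
    by (simp add: Delta_id_Gamma merge_def mu_def)
  show "\<forall>x :: 'a list \<Rightarrow>\<^sub>0 'k. tmapf_left eps (Gamma x) = unitH (eps x)"
    by (simp add: eps_id_Gamma)
  show "\<forall>x :: 'a list \<Rightarrow>\<^sub>0 'k. Gamma (S x) = tmap S (\<lambda>z. z) (Gamma x)"
    by (simp add: Gamma_S)
  show "alg_hom star one_H star2 (tensor one_H one_H) (Delta :: ('a list \<Rightarrow>\<^sub>0 'k) \<Rightarrow> _)"
    by (fact Delta_hom)
  show "alg_hom star2 (tensor one_H one_H) (tprod star2 star) (tensor (tensor one_H one_H) one_H)
       (tmap Delta (\<lambda>z. z) :: (('a list \<times> 'a list) \<Rightarrow>\<^sub>0 'k) \<Rightarrow> _)"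
    by (intro alg_hom_tmap bilinear linear Delta_hom alg_hom_ident)
  show "alg_hom star2 (tensor one_H one_H) (tprod star2 star2)
       (tensor (tensor one_H one_H) (tensor one_H one_H))
       (tmap Gamma Gamma :: (('a list \<times> 'a list) \<Rightarrow>\<^sub>0 'k) \<Rightarrow> _)"
    by (intro alg_hom_tmap bilinear linear Gamma_hom)
  show "alg_hom (tprod star2 star2) (tensor (tensor one_H one_H) (tensor one_H one_H))
       (tprod star2 star2) (tensor (tensor one_H one_H) (tensor one_H one_H))
       (tau23 :: ((('a list \<times> 'a list) \<times> ('a list \<times> 'a list)) \<Rightarrow>\<^sub>0 'k) \<Rightarrow> _)"
    by (intro alg_hom_tau23 bilinear)
  show "alg_hom (tprod star2 star2) (tensor (tensor one_H one_H) (tensor one_H one_H))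
       (tprod star2 star) (tensor (tensor one_H one_H) one_H)
       (tmap (\<lambda>z. z) (lin (\<lambda>(b, d). star (bvec b) (bvec d)))
         :: ((('a list \<times> 'a list) \<times> ('a list \<times> 'a list)) \<Rightarrow>\<^sub>0 'k) \<Rightarrow> _)"
    unfolding mu_def[symmetric] by (intro alg_hom_tmap bilinear linear alg_hom_mu alg_hom_ident)
  show "alg_hom star2 (tensor one_H one_H) star one_H
       (tmapf_left eps :: (('a list \<times> 'a list) \<Rightarrow>\<^sub>0 'k) \<Rightarrow> _)"
    by (fact alg_hom_eps_id)
  show "alg_hom star one_H (*) 1 (eps :: ('a list \<Rightarrow>\<^sub>0 'k) \<Rightarrow> 'k)"
    by (simp add: alg_hom_def eps_star eps_bvec)
  show "alg_hom (*) 1 star one_H (unitH :: 'k \<Rightarrow> ('a list \<Rightarrow>\<^sub>0 'k))"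
    by (simp add: alg_hom_def unitH_def star_simps)
  show "alg_hom star one_H star one_H (S :: ('a list \<Rightarrow>\<^sub>0 'k) \<Rightarrow> _)"
    by (fact S_hom)
  show "alg_hom star2 (tensor one_H one_H) star2 (tensor one_H one_H)
       (tmap S (\<lambda>z. z) :: (('a list \<times> 'a list) \<Rightarrow>\<^sub>0 'k) \<Rightarrow> _)"
    by (intro alg_hom_tmap bilinear linear S_hom alg_hom_ident)
qed

end
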